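(* Let $R$ be a left Artinian ring and let $\mathfrak l=\mathfrak l_R$ be its left localization radical. Then: 1. $\mathfrak l=\bigcap_{e\in\min\mathcal I_l'(R)}(1-e)R=\prod_{e\in\min\mathcal I_l'(R)}(1-e)R=\Bigl(1-\sum_{e\in\min\mathcal I_l'(R)}e\Bigr)R$. If, in addition, $R$ is a right Artinian ring, then $\mathfrak l=\prod_{f\in\max\mathcal I_r''(R)}fR$. 2. Write $\min\mathcal I_l'(R)=\{e_1,\dots,e_t\}$ (distinct elements), $e_{t+1}=1-\sum_{i=1}^te_i$ and $R_{ij}=e_iRe_j$. Then $$\mathfrak l=\begin{cases}\bigoplus_{i=1}^{t+1}R_{t+1,i}\neq0&\text{if }1\neq\sum_{e\in\min\mathcal I_l'(R)}e,\\ 0&\text{otherwise.}\end{cases}$$ 3. $\mathfrak l^2=\mathfrak l$ and $\mathfrak l$ is a projective right $R$-module. 4. $\mathfrak l\subseteq\mathrm{rad}(R)$ iff $\mathfrak l=0$.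
   Context: Rings are associative with $1$; $\mathrm{rad}(R)$ is the Jacobson radical. A multiplicative set $S\subseteq R$ satisfies $1\in S$, $SS\subseteq S$, $0\notin S$. It is a left Ore set if $Sr\cap Rs\neq\emptyset$ for all $r\in R$, $s\in S$; put $\mathrm{ass}(S)=\{r\in R:sr=0\text{ for some }s\in S\}$. A left Ore set $S$ is a left denominator set if $rs=0$ with $r\in R$, $s\in S$ implies $tr=0$ for some $t\in S$. $\mathrm{max.Den}_l(R)$ is the set of maximal (with respect to inclusion) left denominator sets. The left localization radical of $R$ is $\mathfrak l_R=\bigcap_{S\in\mathrm{max.Den}_l(R)}\mathrm{ass}(S)$. For $R$ left Artinian, write $R/\mathrm{rad}(R)=\prod_{i=1}^s\overline R_i$, a product of simple Artinian rings, with $\overline1_i$ the identity of $\overline R_i$. Fix orthogonal idempotents $1_1,\dots,1_s$ of $R$ with $1=\sum_i1_i$ and $1_i+\mathrm{rad}(R)=\overline1_i$. For $I\subseteq\{1,\dots,s\}$ put $e_I=\sum_{i\in I}1_i$. $\mathcal I_l'(R)=\{e_I:\emptyset\neq I\subseteq\{1,\dots,s\},\ e_IR(1-e_I)=0\}$, partially ordered by $e_I\geq e_J$ iff $I\supseteq J$; $\min\mathcal I_l'(R)$ is its set of minimal elements (distinct minimal elements are orthogonal). $\mathcal I_r''(R)=\{e_J:\emptyset\neq J\subsetneq\{1,\dots,s\},\ (1-e_J)Re_J=0\}$, with the same order, and $\max\mathcal I_r''(R)$ is its set of maximal elements. The ideals occurring in the products commute, so the products do not depend on the order of factors.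
   Formalization: In part 1, when max I_r''(R) is empty (e.g. R a field, where the localization radical is 0 but the empty product of ideals is R), the product formula is replaced by the assertion that the localization radical is 0; otherwise it is stated as written. *)

theory Defs
  imports "HOL-Algebra.QuotRing" "HOL-Algebra.Ideal_Product"
begin

section \<open>One-sided ideals, chain conditions, the Jacobson radical\<close>

locale left_ideal = additive_subgroup I R + ring R for I and R (structure) +
  assumes l_closed: "\<lbrakk>a \<in> I; x \<in> carrier R\<rbrakk> \<Longrightarrow> x \<otimes> a \<in> I"

locale right_ideal = additive_subgroup I R + ring R for I and R (structure) +
  assumes r_closed: "\<lbrakk>a \<in> I; x \<in> carrier R\<rbrakk> \<Longrightarrow> a \<otimes> x \<in> I"

definition left_artinian :: "('a, 'b) ring_scheme \<Rightarrow> bool" where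
  "left_artinian R \<longleftrightarrow> ring R \<and>
     (\<forall>I :: nat \<Rightarrow> 'a set. (\<forall>n. left_ideal (I n) R \<and> I (Suc n) \<subseteq> I n) \<longrightarrow>
        (\<exists>N. \<forall>n\<ge>N. I n = I N))"

definition right_artinian :: "('a, 'b) ring_scheme \<Rightarrow> bool" where
  "right_artinian R \<longleftrightarrow> ring R \<and>
     (\<forall>I :: nat \<Rightarrow> 'a set. (\<forall>n. right_ideal (I n) R \<and> I (Suc n) \<subseteq> I n) \<longrightarrow>
        (\<exists>N. \<forall>n\<ge>N. I n = I N))"

definition maximal_left_ideal :: "'a set \<Rightarrow> ('a, 'b) ring_scheme \<Rightarrow> bool" where
  "maximal_left_ideal I R \<longleftrightarrow> left_ideal I R \<and> I \<noteq> carrier R \<and>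
     (\<forall>J. left_ideal J R \<and> I \<subseteq> J \<longrightarrow> J = I \<or> J = carrier R)"

text \<open>Here and below, intersections of families of subsets of \<open>R\<close> are cut down to the carrier,
  so that the empty family (which occurs for the zero ring) has intersection \<open>R\<close>.\<close>

definition jacobson_radical :: "('a, 'b) ring_scheme \<Rightarrow> 'a set" where
  "jacobson_radical R = carrier R \<inter> \<Inter>{I. maximal_left_ideal I R}"

definition simple_ring :: "('a, 'b) ring_scheme \<Rightarrow> bool" where
  "simple_ring R \<longleftrightarrow> ring R \<and> carrier R \<noteq> {\<zero>\<^bsub>R\<^esub>} \<and>
     (\<forall>I. ideal I R \<longrightarrow> I = {\<zero>\<^bsub>R\<^esub>} \<or> I = carrier R)"

text \<open>\<open>M\<close> is the internal direct sum of the additive subgroups \<open>A i\<close>, \<open>i \<in> J\<close>, for finite \<open>J\<close>.\<close>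

definition internal_direct_sum ::
    "('a, 'b) ring_scheme \<Rightarrow> 'i set \<Rightarrow> ('i \<Rightarrow> 'a set) \<Rightarrow> 'a set \<Rightarrow> bool" where
  "internal_direct_sum R J A M \<longleftrightarrow> finite J \<and> (\<forall>i\<in>J. additive_subgroup (A i) R) \<and>
     bij_betw (\<lambda>x. \<Oplus>\<^bsub>R\<^esub>i\<in>J. x i) (\<Pi>\<^sub>E i\<in>J. A i) M"

section \<open>Left denominator sets and the left localization radical\<close>

definition multiplicative_set :: "('a, 'b) ring_scheme \<Rightarrow> 'a set \<Rightarrow> bool" where
  "multiplicative_set R S \<longleftrightarrow> submonoid S R \<and> \<zero>\<^bsub>R\<^esub> \<notin> S"

definition left_ore_set :: "('a, 'b) ring_scheme \<Rightarrow> 'a set \<Rightarrow> bool" where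
  "left_ore_set R S \<longleftrightarrow> multiplicative_set R S \<and>
     (\<forall>r\<in>carrier R. \<forall>s\<in>S. (S #>\<^bsub>R\<^esub> r) \<inter> (carrier R #>\<^bsub>R\<^esub> s) \<noteq> {})"

definition ass :: "('a, 'b) ring_scheme \<Rightarrow> 'a set \<Rightarrow> 'a set" where
  "ass R S = {r \<in> carrier R. \<exists>s\<in>S. s \<otimes>\<^bsub>R\<^esub> r = \<zero>\<^bsub>R\<^esub>}"

definition left_denominator_set :: "('a, 'b) ring_scheme \<Rightarrow> 'a set \<Rightarrow> bool" where
  "left_denominator_set R S \<longleftrightarrow> left_ore_set R S \<and>
     (\<forall>r\<in>carrier R. \<forall>s\<in>S. r \<otimes>\<^bsub>R\<^esub> s = \<zero>\<^bsub>R\<^esub> \<longrightarrow> (\<exists>t\<in>S. t \<otimes>\<^bsub>R\<^esub> r = \<zero>\<^bsub>R\<^esub>))"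

definition max_Den_l :: "('a, 'b) ring_scheme \<Rightarrow> 'a set set" where
  "max_Den_l R = {S. left_denominator_set R S \<and>
     (\<forall>T. left_denominator_set R T \<and> S \<subseteq> T \<longrightarrow> T = S)}"

definition left_localization_radical :: "('a, 'b) ring_scheme \<Rightarrow> 'a set" where
  "left_localization_radical R = carrier R \<inter> (\<Inter>S\<in>max_Den_l R. ass R S)"

section \<open>The posets of idempotents\<close>

text \<open>Throughout, \<open>u 1, \<dots>, u s\<close> stand for the idempotents \<open>1\<^sub>1, \<dots>, 1\<^sub>s\<close>.\<close>

definition idem_sum :: "('a, 'b) ring_scheme \<Rightarrow> (nat \<Rightarrow> 'a) \<Rightarrow> nat set \<Rightarrow> 'a" where
  "idem_sum R u I = (\<Oplus>\<^bsub>R\<^esub>i\<in>I. u i)"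

definition right_princ :: "('a, 'b) ring_scheme \<Rightarrow> 'a \<Rightarrow> 'a set" where
  "right_princ R e = e <#\<^bsub>R\<^esub> carrier R"

definition peirce :: "('a, 'b) ring_scheme \<Rightarrow> 'a \<Rightarrow> 'a \<Rightarrow> 'a set" where
  "peirce R e f = (e <#\<^bsub>R\<^esub> carrier R) #>\<^bsub>R\<^esub> f"

definition I_l' :: "('a, 'b) ring_scheme \<Rightarrow> (nat \<Rightarrow> 'a) \<Rightarrow> nat \<Rightarrow> 'a set" where
  "I_l' R u s = {idem_sum R u I | I. I \<noteq> {} \<and> I \<subseteq> {1..s} \<and>
     peirce R (idem_sum R u I) (\<one>\<^bsub>R\<^esub> \<ominus>\<^bsub>R\<^esub> idem_sum R u I) = {\<zero>\<^bsub>R\<^esub>}}"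

definition I_r'' :: "('a, 'b) ring_scheme \<Rightarrow> (nat \<Rightarrow> 'a) \<Rightarrow> nat \<Rightarrow> 'a set" where
  "I_r'' R u s = {idem_sum R u J | J. J \<noteq> {} \<and> J \<subset> {1..s} \<and>
     peirce R (\<one>\<^bsub>R\<^esub> \<ominus>\<^bsub>R\<^esub> idem_sum R u J) (idem_sum R u J) = {\<zero>\<^bsub>R\<^esub>}}"

definition idem_le :: "('a, 'b) ring_scheme \<Rightarrow> (nat \<Rightarrow> 'a) \<Rightarrow> nat \<Rightarrow> 'a \<Rightarrow> 'a \<Rightarrow> bool" where
  "idem_le R u s f e \<longleftrightarrow>
     (\<exists>I J. I \<subseteq> {1..s} \<and> J \<subseteq> I \<and> e = idem_sum R u I \<and> f = idem_sum R u J)"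

definition min_I_l' :: "('a, 'b) ring_scheme \<Rightarrow> (nat \<Rightarrow> 'a) \<Rightarrow> nat \<Rightarrow> 'a set" where
  "min_I_l' R u s = {e \<in> I_l' R u s. \<forall>f\<in>I_l' R u s. idem_le R u s f e \<longrightarrow> f = e}"

definition max_I_r'' :: "('a, 'b) ring_scheme \<Rightarrow> (nat \<Rightarrow> 'a) \<Rightarrow> nat \<Rightarrow> 'a set" where
  "max_I_r'' R u s = {e \<in> I_r'' R u s. \<forall>f\<in>I_r'' R u s. idem_le R u s e f \<longrightarrow> f = e}"

lemma finite_min_I_l': "finite (min_I_l' R u s)"
proof (rule finite_subset)
  show "min_I_l' R u s \<subseteq> idem_sum R u ` Pow {1..s}"
    unfolding min_I_l'_def I_l'_def by blast
qed simp

lemma finite_max_I_r'': "finite (max_I_r'' R u s)"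
proof (rule finite_subset)
  show "max_I_r'' R u s \<subseteq> idem_sum R u ` Pow {1..s}"
    unfolding max_I_r''_def I_r''_def by blast
qed simp

section \<open>Products of ideals\<close>

definition ideal_list_prod :: "('a, 'b) ring_scheme \<Rightarrow> 'a set list \<Rightarrow> 'a set" where
  "ideal_list_prod R Is = foldr (ideal_prod R) Is (carrier R)"

text \<open>\<open>P\<close> is the product of the ideals \<open>A e\<close>, \<open>e \<in> K\<close>, for finite \<open>K\<close>, in whatever order the
  factors are multiplied. The empty product is \<open>R\<close>.\<close>

definition is_ideal_prod ::
    "('a, 'b) ring_scheme \<Rightarrow> 'c set \<Rightarrow> ('c \<Rightarrow> 'a set) \<Rightarrow> 'a set \<Rightarrow> bool" where
  "is_ideal_prod R K A P \<longleftrightarrow> finite K \<and>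
     (\<forall>es. distinct es \<and> set es = K \<longrightarrow> ideal_list_prod R (map A es) = P)"

section \<open>Projective right modules over a noncommutative ring\<close>

text \<open>A right module is given by its additive group (the multiplicative components of the
  record \<open>M\<close> are irrelevant) and the action \<open>act m r = m r\<close>.\<close>

locale right_module = R?: ring R + M?: abelian_group M
  for R (structure) and M (structure) and act :: "'m \<Rightarrow> 'a \<Rightarrow> 'm" +
  assumes act_closed: "\<lbrakk>x \<in> carrier M; a \<in> carrier R\<rbrakk> \<Longrightarrow> act x a \<in> carrier M"
    and act_add_ring: "\<lbrakk>x \<in> carrier M; a \<in> carrier R; b \<in> carrier R\<rbrakk> \<Longrightarrow>
      act x (a \<oplus> b) = act x a \<oplus>\<^bsub>M\<^esub> act x b"
    and act_add_module: "\<lbrakk>x \<in> carrier M; y \<in> carrier M; a \<in> carrier R\<rbrakk> \<Longrightarrow>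
      act (x \<oplus>\<^bsub>M\<^esub> y) a = act x a \<oplus>\<^bsub>M\<^esub> act y a"
    and act_mult: "\<lbrakk>x \<in> carrier M; a \<in> carrier R; b \<in> carrier R\<rbrakk> \<Longrightarrow>
      act x (a \<otimes> b) = act (act x a) b"
    and act_one: "x \<in> carrier M \<Longrightarrow> act x \<one> = x"

definition right_module_hom ::
    "('a, 'b) ring_scheme \<Rightarrow> ('m, 'c) ring_scheme \<Rightarrow> ('m \<Rightarrow> 'a \<Rightarrow> 'm) \<Rightarrow>
     ('n, 'd) ring_scheme \<Rightarrow> ('n \<Rightarrow> 'a \<Rightarrow> 'n) \<Rightarrow> ('m \<Rightarrow> 'n) set" where
  "right_module_hom R M actM N actN = {f \<in> carrier M \<rightarrow> carrier N.
     (\<forall>x\<in>carrier M. \<forall>y\<in>carrier M. f (x \<oplus>\<^bsub>M\<^esub> y) = f x \<oplus>\<^bsub>N\<^esub> f y) \<and>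
     (\<forall>x\<in>carrier M. \<forall>a\<in>carrier R. f (actM x a) = actN (f x) a)}"

text \<open>The lifting property of \<open>P\<close> against all epimorphisms \<open>p: M \<rightarrow> N\<close>. A definition cannot
  quantify over types, so the types of the elements of \<open>M\<close> and \<open>N\<close> are parameters; in a theorem
  with free type variables in their place, \<open>M\<close> and \<open>N\<close> range over all right modules.\<close>

definition projective_right_module ::
    "'m itself \<Rightarrow> 'n itself \<Rightarrow> ('a, 'b) ring_scheme \<Rightarrow> ('p, 'c) ring_scheme \<Rightarrow>
     ('p \<Rightarrow> 'a \<Rightarrow> 'p) \<Rightarrow> bool" where
  "projective_right_module TM TN R P actP \<longleftrightarrow> right_module R P actP \<and>
     (\<forall>(M :: 'm ring) actM (N :: 'n ring) actN.
        right_module R M actM \<longrightarrow> right_module R N actN \<longrightarrow>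
        (\<forall>p \<in> right_module_hom R M actM N actN. \<forall>g \<in> right_module_hom R P actP N actN.
           p ` carrier M = carrier N \<longrightarrow>
           (\<exists>h \<in> right_module_hom R P actP M actM. \<forall>x\<in>carrier P. p (h x) = g x)))"

end

theory Submission
  imports Defs
begin

text \<open>
  For an idempotent \<open>e\<close> with \<open>e R (1 - e) = 0\<close> the right ideal \<open>(1 - e) R\<close> is the right annihilator
  of \<open>e\<close> and is a two-sided ideal. The theorem rests on a description of all maximal left denominator
  sets: for each minimal element \<open>e\<close> of \<open>\<I>\<^sub>l'(R)\<close> there is exactly one, the set of elements
  that become units modulo \<open>(1 - e) R\<close>, and its \<open>ass\<close> is \<open>(1 - e) R\<close>.

  The description has three ingredients. First (\<open>left_denominator_set_idempotent\<close>), let \<open>S\<close> be a left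
  denominator set of a left Artinian ring and choose \<open>s \<in> S\<close> with \<open>R s\<close> minimal. The Ore condition
  makes \<open>R s\<close> the least of all \<open>R t\<close>, \<open>t \<in> S\<close>, so \<open>s\<close> annihilates all of \<open>ass(S)\<close>. From
  \<open>R s = R s s\<close> one gets \<open>s = y s s\<close>, and \<open>e = y s\<close> is an idempotent with \<open>e R (1 - e) = 0\<close> and
  \<open>ass(S) = (1 - e) R\<close>; every element of \<open>S\<close> is a unit modulo this ideal. Secondly
  (\<open>left_denominator_set_units_mod\<close>), for any such \<open>e \<noteq> 0\<close> the units modulo \<open>(1 - e) R\<close> form a left
  denominator set. Thirdly (\<open>semicentral_right_ann_eq\<close>), the ideal \<open>(1 - e) R\<close> is generated by one
  of the idempotents \<open>1 - e\<^sub>I\<close>: the components of \<open>R / rad(R)\<close> being simple, every ideal either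
  contains \<open>1\<^sub>i\<close> modulo the radical or is sent into the radical by \<open>1\<^sub>i\<close>, and for a suitable
  \<open>I\<close> both \<open>e (1 - e\<^sub>I)\<close> and \<open>e\<^sub>I (1 - e)\<close> are idempotents in the radical, hence zero. Enlarging the ideal
  \<open>(1 - e\<^sub>I) R\<close> enlarges the set of units modulo it, so maximal denominator sets belong to
  minimal \<open>I\<close>.

  Consequently the localization radical consists of the elements annihilated by all minimal
  \<open>e\<close>. These are pairwise orthogonal, so their sum \<open>h\<close> is idempotent and the localization radical is
  \<open>(1 - h) R\<close>, a right ideal generated by an idempotent; all four assertions follow from this.
\<close>

section \<open>Idempotents and the right ideals they generate\<close>

definition right_ann :: "('a, 'b) ring_scheme \<Rightarrow> 'a \<Rightarrow> 'a set" where
  "right_ann R a = {r \<in> carrier R. a \<otimes>\<^bsub>R\<^esub> r = \<zero>\<^bsub>R\<^esub>}"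

text \<open>Equivalent to \<open>e R (1 - e) = 0\<close> for idempotent \<open>e\<close> (see \<open>peirce_compl_trivial_iff\<close>); in this
  form the condition can be used without subtraction.\<close>

definition right_semicentral :: "('a, 'b) ring_scheme \<Rightarrow> 'a \<Rightarrow> bool" where
  "right_semicentral R e \<longleftrightarrow> e \<in> carrier R \<and> e \<otimes>\<^bsub>R\<^esub> e = e \<and>
     (\<forall>r\<in>carrier R. e \<otimes>\<^bsub>R\<^esub> r \<otimes>\<^bsub>R\<^esub> e = e \<otimes>\<^bsub>R\<^esub> r)"

lemma mem_right_princ_iff: "x \<in> right_princ R e \<longleftrightarrow> (\<exists>r\<in>carrier R. x = e \<otimes>\<^bsub>R\<^esub> r)"
  by (auto simp: right_princ_def l_coset_def)

lemma mem_peirce_iff: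
  "x \<in> peirce R e f \<longleftrightarrow> (\<exists>r\<in>carrier R. x = e \<otimes>\<^bsub>R\<^esub> r \<otimes>\<^bsub>R\<^esub> f)"
  by (auto simp: peirce_def l_coset_def r_coset_def)

context ring
begin

lemma minus_l_distr:
  assumes "a \<in> carrier R" "b \<in> carrier R" "c \<in> carrier R"
  shows "(a \<ominus> b) \<otimes> c = a \<otimes> c \<ominus> b \<otimes> c"
  using assms by (simp add: minus_eq l_distr l_minus)

lemma minus_r_distr:
  assumes "a \<in> carrier R" "b \<in> carrier R" "c \<in> carrier R"
  shows "c \<otimes> (a \<ominus> b) = c \<otimes> a \<ominus> c \<otimes> b"
  using assms by (simp add: minus_eq r_distr r_minus)

lemma minus_minus_self:
  assumes "a \<in> carrier R" "b \<in> carrier R"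
  shows "a \<ominus> (a \<ominus> b) = b"
  using assms by algebra

lemma minus_add_cancel:
  assumes "a \<in> carrier R" "b \<in> carrier R"
  shows "(a \<ominus> b) \<oplus> b = a"
  using assms by algebra

lemma minus_eq_zero_iff:
  assumes "a \<in> carrier R" "b \<in> carrier R"
  shows "a \<ominus> b = \<zero> \<longleftrightarrow> a = b"
proof
  assume "a \<ominus> b = \<zero>"
  moreover have "a = (a \<ominus> b) \<oplus> b" using assms by algebra
  ultimately show "a = b" using assms by simp
qed (use assms in \<open>simp add: minus_eq r_neg\<close>)

lemma idempotent_compl:
  assumes "e \<in> carrier R" "e \<otimes> e = e"
  shows "(\<one> \<ominus> e) \<otimes> (\<one> \<ominus> e) = \<one> \<ominus> e"
proof -
  have "(\<one> \<ominus> e) \<otimes> (\<one> \<ominus> e) = \<one> \<ominus> e \<ominus> (e \<ominus> e)"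
    using assms by (simp add: minus_l_distr minus_r_distr)
  also have "\<dots> = \<one> \<ominus> e" using assms by algebra
  finally show ?thesis .
qed

lemma right_princ_idempotent:
  assumes "e \<in> carrier R" "e \<otimes> e = e"
  shows "right_princ R e = {r \<in> carrier R. e \<otimes> r = r}"
proof
  show "right_princ R e \<subseteq> {r \<in> carrier R. e \<otimes> r = r}"
    using assms by (auto simp: mem_right_princ_iff simp flip: m_assoc)
  show "{r \<in> carrier R. e \<otimes> r = r} \<subseteq> right_princ R e"
  proof
    fix x assume "x \<in> {r \<in> carrier R. e \<otimes> r = r}"
    then have "x \<in> carrier R" "x = e \<otimes> x" by simp_all
    then show "x \<in> right_princ R e" unfolding mem_right_princ_iff by (rule bexI[rotated])
  qed
qed

lemma right_princ_eq_zero_iff: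
  assumes "g \<in> carrier R" "g \<otimes> g = g"
  shows "right_princ R g = {\<zero>} \<longleftrightarrow> g = \<zero>"
proof
  have "g \<in> right_princ R g" using assms by (simp add: right_princ_idempotent)
  then show "g = \<zero>" if "right_princ R g = {\<zero>}" using that by simp
  assume g: "g = \<zero>"
  have "right_princ R \<zero> = {r \<in> carrier R. \<zero> \<otimes> r = r}"
    by (rule right_princ_idempotent) simp_all
  also have "\<dots> = {\<zero>}"
  proof (intro subset_antisym subsetI)
    fix r assume "r \<in> {r \<in> carrier R. \<zero> \<otimes> r = r}"
    then have "r \<in> carrier R" "\<zero> \<otimes> r = r" by blast+
    then show "r \<in> {\<zero>}" using l_null[of r] by simp
  qed simp
  finally show "right_princ R g = {\<zero>}" unfolding g .
qed

lemma right_princ_compl: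
  assumes "e \<in> carrier R" "e \<otimes> e = e"
  shows "right_princ R (\<one> \<ominus> e) = right_ann R e"
proof -
  have "(\<one> \<ominus> e) \<otimes> r = r \<longleftrightarrow> e \<otimes> r = \<zero>" if r: "r \<in> carrier R" for r
  proof -
    have "(\<one> \<ominus> e) \<otimes> r = r \<ominus> e \<otimes> r"
      using assms r by (simp add: minus_l_distr)
    moreover have "r \<ominus> e \<otimes> r = r \<longleftrightarrow> e \<otimes> r = \<zero>"
    proof
      assume "r \<ominus> e \<otimes> r = r"
      then have "r \<ominus> (r \<ominus> e \<otimes> r) = \<zero>" using r by (simp add: minus_eq_zero_iff)
      then show "e \<otimes> r = \<zero>" using assms r by (simp add: minus_minus_self)
    qed (use r in \<open>simp add: minus_eq\<close>)
    ultimately show ?thesis by simp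
  qed
  then show ?thesis
    using right_princ_idempotent[OF _ idempotent_compl[OF assms]] assms
    by (auto simp: right_ann_def)
qed

lemma mult_compl_zero_iff:
  assumes "a \<in> carrier R" "e \<in> carrier R"
  shows "a \<otimes> (\<one> \<ominus> e) = \<zero> \<longleftrightarrow> a \<otimes> e = a"
proof -
  have "a \<otimes> (\<one> \<ominus> e) = a \<ominus> a \<otimes> e" using assms by (simp add: minus_r_distr)
  moreover have "a \<ominus> a \<otimes> e = \<zero> \<longleftrightarrow> a = a \<otimes> e"
    using assms by (intro minus_eq_zero_iff) simp_all
  ultimately show ?thesis by (simp only:) (rule eq_commute)
qed

lemma peirce_compl_trivial_iff:
  assumes e: "e \<in> carrier R" "e \<otimes> e = e"
  shows "peirce R e (\<one> \<ominus> e) = {\<zero>} \<longleftrightarrow> right_semicentral R e"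
proof -
  have "\<zero> \<in> peirce R e (\<one> \<ominus> e)"
    using e unfolding mem_peirce_iff by (intro bexI[of _ \<zero>]) simp_all
  then have "peirce R e (\<one> \<ominus> e) = {\<zero>} \<longleftrightarrow> (\<forall>x\<in>peirce R e (\<one> \<ominus> e). x = \<zero>)"
    by blast
  also have "\<dots> \<longleftrightarrow> (\<forall>r\<in>carrier R. e \<otimes> r \<otimes> (\<one> \<ominus> e) = \<zero>)"
    unfolding Ball_def mem_peirce_iff by blast
  also have "\<dots> \<longleftrightarrow> (\<forall>r\<in>carrier R. e \<otimes> r \<otimes> e = e \<otimes> r)"
    using e by (intro ball_cong refl mult_compl_zero_iff) simp_all
  also have "\<dots> \<longleftrightarrow> right_semicentral R e"
    using e by (simp add: right_semicentral_def)
  finally show ?thesis .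
qed

text \<open>An element \<open>x\<close> of an intersection of such ideals lies in the product because
  \<open>x = (1 - e) x\<close> with \<open>1 - e\<close> in the first factor. So products of these ideals are intersections,
  whatever the order of the factors.\<close>

lemma ideal_list_prod_right_ann:
  assumes "\<And>e. e \<in> set es \<Longrightarrow> right_semicentral R e"
  shows "ideal_list_prod R (map (right_ann R) es)
       = {r \<in> carrier R. \<forall>e\<in>set es. e \<otimes> r = \<zero>}"
  using assms
proof (induction es)
  case Nil
  then show ?case by (simp add: ideal_list_prod_def)
next
  case (Cons e es)
  let ?X = "{r \<in> carrier R. \<forall>e\<in>set es. e \<otimes> r = \<zero>}"
  have e: "e \<in> carrier R" "e \<otimes> e = e"
    using Cons.prems[of e] by (auto simp: right_semicentral_def)
  have kill: "f \<otimes> (i \<otimes> j) = \<zero>"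
    if "right_semicentral R f" "i \<in> carrier R" "j \<in> carrier R" "f \<otimes> j = \<zero>" for f i j
  proof -
    have "f \<otimes> (i \<otimes> j) = f \<otimes> i \<otimes> j"
      using that by (simp add: right_semicentral_def m_assoc)
    also have "\<dots> = f \<otimes> i \<otimes> f \<otimes> j"
      using that by (simp add: right_semicentral_def)
    also have "\<dots> = f \<otimes> i \<otimes> (f \<otimes> j)"
      using that by (intro m_assoc) (auto simp: right_semicentral_def)
    finally show ?thesis using that by (simp add: right_semicentral_def)
  qed
  have "ideal_prod R (right_ann R e) ?X = {r \<in> carrier R. \<forall>f\<in>set (e # es). f \<otimes> r = \<zero>}"
    (is "?L = ?Y")
  proof
    show "?L \<subseteq> ?Y"
    proof
      fix x assume "x \<in> ?L"
      then show "x \<in> ?Y"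
      proof induction
        case (prod i j)
        have "e \<otimes> (i \<otimes> j) = e \<otimes> i \<otimes> j"
          using prod e by (simp add: right_ann_def flip: m_assoc)
        then show ?case
          using prod kill Cons.prems by (auto simp: right_ann_def)
      next
        case (sum a b)
        then show ?case
          using Cons.prems by (auto simp: r_distr right_semicentral_def)
      qed
    qed
    show "?Y \<subseteq> ?L"
    proof
      fix x assume x: "x \<in> ?Y"
      have "\<one> \<ominus> e \<in> right_ann R e"
        using e by (simp add: right_ann_def minus_r_distr minus_eq_zero_iff)
      then have "(\<one> \<ominus> e) \<otimes> x \<in> ?L"
        using x by (intro ideal_prod.prod) auto
      moreover have "(\<one> \<ominus> e) \<otimes> x = x"
        using x e by (simp add: minus_eq l_distr l_minus)
      ultimately show "x \<in> ?L" by simp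
    qed
  qed
  then show ?case
    using Cons by (simp add: ideal_list_prod_def)
qed

lemma ideal_prod_right_princ_self:
  assumes "g \<in> carrier R" "g \<otimes> g = g"
  shows "ideal_prod R (right_princ R g) (right_princ R g) = right_princ R g"
proof
  show "ideal_prod R (right_princ R g) (right_princ R g) \<subseteq> right_princ R g"
  proof
    fix x assume "x \<in> ideal_prod R (right_princ R g) (right_princ R g)"
    then show "x \<in> right_princ R g"
      by induction
        (use assms in \<open>auto simp: right_princ_idempotent r_distr m_assoc[symmetric]\<close>)
  qed
  show "right_princ R g \<subseteq> ideal_prod R (right_princ R g) (right_princ R g)"
  proof
    fix x assume x: "x \<in> right_princ R g"
    then have "g \<otimes> x \<in> ideal_prod R (right_princ R g) (right_princ R g)"
      using assms by (intro ideal_prod.prod) (auto simp: right_princ_idempotent)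
    then show "x \<in> ideal_prod R (right_princ R g) (right_princ R g)"
      using x assms by (simp add: right_princ_idempotent)
  qed
qed

lemma additive_subgroup_closedI:
  assumes "H \<subseteq> carrier R" "\<zero> \<in> H" "\<And>x y. \<lbrakk>x \<in> H; y \<in> H\<rbrakk> \<Longrightarrow> x \<oplus> y \<in> H"
    and "\<And>x. x \<in> H \<Longrightarrow> \<ominus> x \<in> H"
  shows "additive_subgroup H R"
  using assms
  by (intro additive_subgroup.intro subgroup.intro) (auto simp: a_inv_def)

text \<open>A homomorphism \<open>f\<close> on \<open>g R\<close> is determined by \<open>f g\<close>, as \<open>x = g x\<close> there. If \<open>m\<close> is a preimage of
  \<open>f g\<close> then \<open>x \<mapsto> m x\<close> is a lifting of \<open>f\<close>.\<close>

lemma projective_right_princ: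
  assumes g: "g \<in> carrier R" "g \<otimes> g = g"
  shows "projective_right_module TYPE('m) TYPE('n) R (R\<lparr>carrier := right_princ R g\<rparr>) (mult R)"
proof -
  have gx: "g \<otimes> x = x" "x \<in> carrier R" if "x \<in> right_princ R g" for x
    using that g by (auto simp: right_princ_idempotent)
  have ab: "abelian_group (R\<lparr>carrier := right_princ R g\<rparr>)"
  proof (rule abelian_groupI, simp_all)
    fix x assume x: "x \<in> right_princ R g"
    show "\<exists>y\<in>right_princ R g. y \<oplus> x = \<zero>"
      using x g by (intro bexI[of _ "\<ominus> x"]) (auto simp: right_princ_idempotent r_minus l_neg)
  qed (use g in \<open>auto simp: right_princ_idempotent r_distr a_ac\<close>)
  have mod: "right_module R (R\<lparr>carrier := right_princ R g\<rparr>) (mult R)"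
  proof (intro right_module.intro right_module_axioms.intro)
    show "ring R" by (rule ring_axioms)
  qed (use ab g in \<open>auto simp: right_princ_idempotent r_distr l_distr m_assoc[symmetric]\<close>)
  show ?thesis
    unfolding projective_right_module_def
  proof (intro conjI mod allI impI ballI)
    fix M :: "'m ring" and actM and N :: "'n ring" and actN p f
    assume M: "right_module R M actM" and N: "right_module R N actN"
      and p: "p \<in> right_module_hom R M actM N actN"
      and f: "f \<in> right_module_hom R (R\<lparr>carrier := right_princ R g\<rparr>) (mult R) N actN"
      and surj: "p ` carrier M = carrier N"
    have gin: "g \<in> right_princ R g" using g by (simp add: right_princ_idempotent)
    then have "f g \<in> carrier N" using f by (auto simp: right_module_hom_def)
    then obtain m where m: "m \<in> carrier M" "p m = f g" using surj by force
    interpret M: right_module R M actM by (rule M)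
    show "\<exists>h\<in>right_module_hom R (R\<lparr>carrier := right_princ R g\<rparr>) (mult R) M actM.
            \<forall>x\<in>carrier (R\<lparr>carrier := right_princ R g\<rparr>). p (h x) = f x"
    proof (intro bexI[of _ "actM m"] ballI)
      fix x assume x: "x \<in> carrier (R\<lparr>carrier := right_princ R g\<rparr>)"
      then have "p (actM m x) = actN (f g) x"
        using p m gx by (auto simp: right_module_hom_def)
      also have "\<dots> = f (g \<otimes> x)"
        using f gin x gx(2)[of x] by (auto simp: right_module_hom_def)
      finally show "p (actM m x) = f x" using x gx by simp
    next
      show "actM m \<in> right_module_hom R (R\<lparr>carrier := right_princ R g\<rparr>) (mult R) M actM"
        using m gx by (auto simp: right_module_hom_def M.act_closed M.act_add_ring M.act_mult)
    qed
  qed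
qed

section \<open>Finite families of orthogonal idempotents\<close>

lemma orthogonal_sum_absorb:
  assumes "finite A" "f \<in> A \<rightarrow> carrier R"
    and "\<And>i. i \<in> A \<Longrightarrow> f i \<otimes> f i = f i"
    and "\<And>i j. \<lbrakk>i \<in> A; j \<in> A; i \<noteq> j\<rbrakk> \<Longrightarrow> f i \<otimes> f j = \<zero>"
    and "i \<in> A" "J \<subseteq> A"
  shows "f i \<otimes> (\<Oplus>j\<in>J. f j) = (if i \<in> J then f i else \<zero>)"
proof -
  have J: "finite J" "f \<in> J \<rightarrow> carrier R" using assms finite_subset by (blast, blast)
  have "f i \<otimes> (\<Oplus>j\<in>J. f j) = (\<Oplus>j\<in>J. f i \<otimes> f j)"
    using J assms by (intro finsum_rdistr) auto
  also have "\<dots> = (\<Oplus>j\<in>J. if i = j then f j else \<zero>)"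
    using J assms by (intro finsum_cong') (auto simp: Pi_iff)
  also have "\<dots> = (if i \<in> J then f i else \<zero>)"
  proof (cases "i \<in> J")
    case True
    then show ?thesis using finsum_singleton[of i J f] J by simp
  next
    case False
    then have "(\<Oplus>j\<in>J. if i = j then f j else \<zero>) = (\<Oplus>j\<in>J. \<zero>)"
      by (intro finsum_cong') auto
    then show ?thesis using False by simp
  qed
  finally show ?thesis .
qed

lemma orthogonal_sum_mult:
  assumes "finite A" "f \<in> A \<rightarrow> carrier R"
    and "\<And>i. i \<in> A \<Longrightarrow> f i \<otimes> f i = f i"
    and "\<And>i j. \<lbrakk>i \<in> A; j \<in> A; i \<noteq> j\<rbrakk> \<Longrightarrow> f i \<otimes> f j = \<zero>"
    and "I \<subseteq> A" "J \<subseteq> A"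
  shows "(\<Oplus>i\<in>I. f i) \<otimes> (\<Oplus>j\<in>J. f j) = (\<Oplus>i\<in>I \<inter> J. f i)"
proof -
  have I: "finite I" "f \<in> I \<rightarrow> carrier R" using assms finite_subset by (blast, blast)
  have Jc: "(\<Oplus>j\<in>J. f j) \<in> carrier R" using assms by (intro finsum_closed) auto
  have "(\<Oplus>i\<in>I. f i) \<otimes> (\<Oplus>j\<in>J. f j) = (\<Oplus>i\<in>I. f i \<otimes> (\<Oplus>j\<in>J. f j))"
    using I Jc by (intro finsum_ldistr) auto
  also have "\<dots> = (\<Oplus>i\<in>I. if i \<in> J then f i else \<zero>)"
    using I assms by (intro finsum_cong') (auto simp: orthogonal_sum_absorb[of A] Pi_iff)
  also have "\<dots> = (\<Oplus>i\<in>I \<inter> J. f i)"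
    using I by (intro add.finprod_mono_neutral_cong_right) auto
  finally show ?thesis .
qed

text \<open>Multiplying \<open>(\<Sum>e) r = 0\<close> on the left by one of the idempotents isolates its summand.\<close>

lemma right_ann_finsum_orthogonal:
  assumes K: "finite K" "K \<subseteq> carrier R"
    and idem: "\<And>e. e \<in> K \<Longrightarrow> e \<otimes> e = e"
    and orth: "\<And>e f. \<lbrakk>e \<in> K; f \<in> K; e \<noteq> f\<rbrakk> \<Longrightarrow> e \<otimes> f = \<zero>"
  shows "right_ann R (\<Oplus>e\<in>K. e) = {r \<in> carrier R. \<forall>e\<in>K. e \<otimes> r = \<zero>}"
proof (intro subset_antisym subsetI)
  let ?h = "\<Oplus>e\<in>K. e"
  have h: "?h \<in> carrier R" using K by (intro finsum_closed) auto
  fix r assume r: "r \<in> right_ann R ?h"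
  have "e \<otimes> r = \<zero>" if e: "e \<in> K" for e
  proof -
    have ec: "e \<in> carrier R" using e K by blast
    have "e \<otimes> ?h = e"
      using orthogonal_sum_absorb[of K "\<lambda>e. e" e K] K e idem orth by auto
    then have "e \<otimes> r = e \<otimes> ?h \<otimes> r" by simp
    also have "\<dots> = e \<otimes> (?h \<otimes> r)" using ec h r by (intro m_assoc) (auto simp: right_ann_def)
    finally show ?thesis using r ec by (simp add: right_ann_def)
  qed
  then show "r \<in> {r \<in> carrier R. \<forall>e\<in>K. e \<otimes> r = \<zero>}" using r by (simp add: right_ann_def)
next
  fix r assume r: "r \<in> {r \<in> carrier R. \<forall>e\<in>K. e \<otimes> r = \<zero>}"
  have "(\<Oplus>e\<in>K. e) \<otimes> r = (\<Oplus>e\<in>K. e \<otimes> r)" using K r by (intro finsum_ldistr) auto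
  also have "\<dots> = (\<Oplus>e\<in>K. \<zero>)" using r by (intro finsum_cong') auto
  finally show "r \<in> right_ann R (\<Oplus>e\<in>K. e)" using r by (simp add: right_ann_def)
qed

text \<open>The inverse of the summation map sends \<open>r\<close> to the family of its components \<open>r (f i)\<close>.\<close>

lemma internal_direct_sum_peirce:
  assumes A: "finite A" and f: "f \<in> A \<rightarrow> carrier R"
    and idem: "\<And>i. i \<in> A \<Longrightarrow> f i \<otimes> f i = f i"
    and orth: "\<And>i j. \<lbrakk>i \<in> A; j \<in> A; i \<noteq> j\<rbrakk> \<Longrightarrow> f i \<otimes> f j = \<zero>"
    and one: "(\<Oplus>i\<in>A. f i) = \<one>" and g: "g \<in> carrier R"
  shows "internal_direct_sum R A (\<lambda>i. peirce R g (f i)) (right_princ R g)"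
  unfolding internal_direct_sum_def
proof (intro conjI ballI A)
  fix i assume i: "i \<in> A"
  have fi: "f i \<in> carrier R" using f i by auto
  show "additive_subgroup (peirce R g (f i)) R"
  proof (rule additive_subgroup_closedI)
    show "peirce R g (f i) \<subseteq> carrier R" using fi g by (auto simp: mem_peirce_iff)
    show "\<zero> \<in> peirce R g (f i)" unfolding mem_peirce_iff using fi g by (intro bexI[of _ \<zero>]) auto
    fix x assume "x \<in> peirce R g (f i)"
    then obtain a where a: "a \<in> carrier R" "x = g \<otimes> a \<otimes> f i" by (auto simp: mem_peirce_iff)
    then show "\<ominus> x \<in> peirce R g (f i)"
      unfolding mem_peirce_iff using fi g by (intro bexI[of _ "\<ominus> a"]) (auto simp: r_minus l_minus)
    fix y assume "y \<in> peirce R g (f i)"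
    then obtain b where b: "b \<in> carrier R" "y = g \<otimes> b \<otimes> f i" by (auto simp: mem_peirce_iff)
    show "x \<oplus> y \<in> peirce R g (f i)"
      unfolding mem_peirce_iff using fi g a b
      by (intro bexI[of _ "a \<oplus> b"]) (auto simp: r_distr l_distr)
  qed
next
  have peirceD: "x \<in> carrier R" "x \<otimes> f j = (if i = j then x else \<zero>)" "x \<in> right_princ R g"
    if x: "x \<in> peirce R g (f i)" and "i \<in> A" "j \<in> A" for x i j
  proof -
    obtain a where a: "a \<in> carrier R" "x = g \<otimes> a \<otimes> f i" using x by (auto simp: mem_peirce_iff)
    have ij: "f i \<in> carrier R" "f j \<in> carrier R" using f that by auto
    show "x \<in> carrier R" using a ij g by simp
    show "x \<in> right_princ R g"
      unfolding mem_right_princ_iff using a ij g by (intro bexI[of _ "a \<otimes> f i"]) (auto simp: m_assoc)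
    have "x \<otimes> f j = g \<otimes> a \<otimes> (f i \<otimes> f j)" using a ij g by (simp add: m_assoc)
    then show "x \<otimes> f j = (if i = j then x else \<zero>)"
      using a ij g idem[OF that(2)] orth[OF that(2,3)] by auto
  qed
  show "bij_betw (\<lambda>x. \<Oplus>i\<in>A. x i) (\<Pi>\<^sub>E i\<in>A. peirce R g (f i)) (right_princ R g)"
  proof (rule bij_betw_byWitness[where f' = "\<lambda>r. \<lambda>i\<in>A. r \<otimes> f i"])
    show "\<forall>x\<in>\<Pi>\<^sub>E i\<in>A. peirce R g (f i). (\<lambda>i\<in>A. (\<Oplus>i\<in>A. x i) \<otimes> f i) = x"
    proof
      fix x assume x: "x \<in> (\<Pi>\<^sub>E i\<in>A. peirce R g (f i))"
      have xp: "x i \<in> peirce R g (f i)" if "i \<in> A" for i using x that by auto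
      have xc: "x \<in> A \<rightarrow> carrier R" using peirceD(1) xp by blast
      have "(\<Oplus>i\<in>A. x i) \<otimes> f j = x j" if j: "j \<in> A" for j
      proof -
        have "(\<Oplus>i\<in>A. x i) \<otimes> f j = (\<Oplus>i\<in>A. x i \<otimes> f j)"
          using A j f xc by (intro finsum_ldistr) auto
        also have "\<dots> = (\<Oplus>i\<in>A. if j = i then x i else \<zero>)"
          using xc j xp peirceD(2)[OF xp _ j] by (intro finsum_cong') (auto simp: Pi_iff)
        also have "\<dots> = x j" using finsum_singleton[of j A x] A j xc by simp
        finally show ?thesis .
      qed
      then show "(\<lambda>i\<in>A. (\<Oplus>i\<in>A. x i) \<otimes> f i) = x"
        using x by (intro extensionalityI[of _ A]) (auto simp: PiE_def)
    qed
    show "\<forall>r\<in>right_princ R g. (\<Oplus>i\<in>A. (\<lambda>i\<in>A. r \<otimes> f i) i) = r"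
    proof
      fix r assume "r \<in> right_princ R g"
      then have r: "r \<in> carrier R" using g by (auto simp: mem_right_princ_iff)
      have "(\<Oplus>i\<in>A. (\<lambda>i\<in>A. r \<otimes> f i) i) = (\<Oplus>i\<in>A. r \<otimes> f i)"
        using r f by (intro finsum_cong') auto
      also have "\<dots> = r \<otimes> (\<Oplus>i\<in>A. f i)" using A r f by (intro finsum_rdistr[symmetric]) auto
      finally show "(\<Oplus>i\<in>A. (\<lambda>i\<in>A. r \<otimes> f i) i) = r" using one r by simp
    qed
    show "(\<lambda>x. \<Oplus>i\<in>A. x i) ` (\<Pi>\<^sub>E i\<in>A. peirce R g (f i)) \<subseteq> right_princ R g"
    proof (intro image_subsetI)
      fix x assume x: "x \<in> (\<Pi>\<^sub>E i\<in>A. peirce R g (f i))"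
      have "\<exists>a\<in>carrier R. x i = g \<otimes> a" if "i \<in> A" for i
        using peirceD(3)[of "x i" i i] x that by (auto simp: mem_right_princ_iff)
      then obtain a where a: "\<And>i. i \<in> A \<Longrightarrow> a i \<in> carrier R \<and> x i = g \<otimes> a i" by metis
      have "(\<Oplus>i\<in>A. x i) = (\<Oplus>i\<in>A. g \<otimes> a i)"
        using a g by (intro finsum_cong') auto
      also have "\<dots> = g \<otimes> (\<Oplus>i\<in>A. a i)" using A a g by (intro finsum_rdistr[symmetric]) auto
      finally show "(\<Oplus>i\<in>A. x i) \<in> right_princ R g"
        unfolding mem_right_princ_iff using a by (intro bexI[of _ "\<Oplus>i\<in>A. a i"]) auto
    qed
    show "(\<lambda>r. \<lambda>i\<in>A. r \<otimes> f i) ` right_princ R g \<subseteq> (\<Pi>\<^sub>E i\<in>A. peirce R g (f i))"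
      by (auto simp: mem_right_princ_iff mem_peirce_iff)
  qed
qed

section \<open>One-sided ideals and the Jacobson radical\<close>

lemma left_idealI:
  assumes "H \<subseteq> carrier R" "\<zero> \<in> H" "\<And>x y. \<lbrakk>x \<in> H; y \<in> H\<rbrakk> \<Longrightarrow> x \<oplus> y \<in> H"
    and l: "\<And>x r. \<lbrakk>x \<in> H; r \<in> carrier R\<rbrakk> \<Longrightarrow> r \<otimes> x \<in> H"
  shows "left_ideal H R"
proof (intro left_ideal.intro left_ideal_axioms.intro additive_subgroup_closedI ring_axioms)
  fix x assume x: "x \<in> H"
  then have "x \<in> carrier R" using assms by auto
  then have "\<ominus> x = \<ominus> \<one> \<otimes> x" by (simp add: l_minus)
  then show "\<ominus> x \<in> H" using l[OF x, of "\<ominus> \<one>"] by simp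
qed (use assms in auto)

lemma left_idealD:
  assumes "left_ideal H R"
  shows "H \<subseteq> carrier R" "\<zero> \<in> H" "\<And>x y. \<lbrakk>x \<in> H; y \<in> H\<rbrakk> \<Longrightarrow> x \<oplus> y \<in> H"
    "\<And>x. x \<in> H \<Longrightarrow> \<ominus> x \<in> H" "\<And>x r. \<lbrakk>x \<in> H; r \<in> carrier R\<rbrakk> \<Longrightarrow> r \<otimes> x \<in> H"
proof -
  interpret left_ideal H R by fact
  show "H \<subseteq> carrier R" "\<zero> \<in> H" "\<And>x y. \<lbrakk>x \<in> H; y \<in> H\<rbrakk> \<Longrightarrow> x \<oplus> y \<in> H"
    "\<And>x. x \<in> H \<Longrightarrow> \<ominus> x \<in> H" "\<And>x r. \<lbrakk>x \<in> H; r \<in> carrier R\<rbrakk> \<Longrightarrow> r \<otimes> x \<in> H"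
    using a_subset l_closed by auto
qed

lemma left_ideal_finsum:
  assumes "left_ideal H R" "finite A" "\<And>i. i \<in> A \<Longrightarrow> f i \<in> H"
  shows "(\<Oplus>i\<in>A. f i) \<in> H"
  using assms(2,3)
proof (induction A)
  case empty
  then show ?case using left_idealD(2)[OF assms(1)] by simp
next
  case (insert a A)
  have "f \<in> A \<rightarrow> carrier R" "f a \<in> carrier R"
    using insert.prems left_idealD(1)[OF assms(1)] by auto
  then have "(\<Oplus>i\<in>insert a A. f i) = f a \<oplus> (\<Oplus>i\<in>A. f i)"
    using insert.hyps by simp
  then show ?case using insert left_idealD(3)[OF assms(1)] by simp
qed

lemma ideal_right_ann:
  assumes e: "right_semicentral R e"
  shows "ideal (right_ann R e) R"
proof (rule idealI[OF ring_axioms])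
  have ec: "e \<in> carrier R" using e by (simp add: right_semicentral_def)
  have l: "r \<otimes> x \<in> right_ann R e" if "x \<in> right_ann R e" "r \<in> carrier R" for x r
  proof -
    have "e \<otimes> (r \<otimes> x) = e \<otimes> r \<otimes> x"
      using ec that by (simp add: m_assoc right_ann_def)
    also have "\<dots> = e \<otimes> r \<otimes> e \<otimes> x" using e that by (simp add: right_semicentral_def)
    also have "\<dots> = e \<otimes> r \<otimes> (e \<otimes> x)" using ec that by (intro m_assoc) (auto simp: right_ann_def)
    finally show ?thesis using ec that by (simp add: right_ann_def)
  qed
  have "left_ideal (right_ann R e) R"
    by (rule left_idealI) (use ec l in \<open>auto simp: right_ann_def r_distr\<close>)
  then show "subgroup (right_ann R e) (add_monoid R)"
    by (intro additive_subgroup.a_subgroup left_ideal.axioms(1))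
  show "r \<otimes> x \<in> right_ann R e" if "x \<in> right_ann R e" "r \<in> carrier R" for x r
    using that by (rule l)
  show "x \<otimes> r \<in> right_ann R e" if "x \<in> right_ann R e" "r \<in> carrier R" for x r
  proof -
    have x: "x \<in> carrier R" "e \<otimes> x = \<zero>" using that by (auto simp: right_ann_def)
    have "e \<otimes> (x \<otimes> r) = e \<otimes> x \<otimes> r" using m_assoc[OF ec x(1) that(2)] ..
    then show ?thesis using that x by (simp add: right_ann_def)
  qed
qed

lemma left_ideal_eq_carrier_iff:
  assumes "left_ideal H R"
  shows "H = carrier R \<longleftrightarrow> \<one> \<in> H"
  using left_idealD(1,5)[OF assms] by (metis one_closed r_one subsetI subset_antisym)

lemma exists_maximal_left_ideal:
  assumes I: "left_ideal I R" "\<one> \<notin> I"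
  shows "\<exists>M. maximal_left_ideal M R \<and> I \<subseteq> M"
proof -
  define \<A> where "\<A> = {J. left_ideal J R \<and> I \<subseteq> J \<and> \<one> \<notin> J}"
  have "\<exists>M\<in>\<A>. \<forall>X\<in>\<A>. M \<subseteq> X \<longrightarrow> X = M"
  proof (rule subset_Zorn_nonempty)
    show "\<A> \<noteq> {}" using I by (auto simp: \<A>_def)
    fix C assume C: "C \<noteq> {}" "subset.chain \<A> C"
    have CA: "X \<in> \<A>" if "X \<in> C" for X using C that by (auto simp: subset.chain_def)
    have "left_ideal (\<Union>C) R"
    proof (rule left_idealI)
      show "\<Union>C \<subseteq> carrier R" using CA left_idealD(1) by (force simp: \<A>_def)
      show "\<zero> \<in> \<Union>C" using C CA left_idealD(2) by (force simp: \<A>_def)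
      show "r \<otimes> x \<in> \<Union>C" if "x \<in> \<Union>C" "r \<in> carrier R" for x r
        using that CA left_idealD(5) by (force simp: \<A>_def)
      fix x y assume "x \<in> \<Union>C" "y \<in> \<Union>C"
      then obtain X Y where XY: "X \<in> C" "Y \<in> C" "x \<in> X" "y \<in> Y" by auto
      then have "X \<subseteq> Y \<or> Y \<subseteq> X" using C(2) by (auto simp: subset.chain_def)
      then obtain Z where Z: "Z \<in> C" "x \<in> Z" "y \<in> Z" using XY by blast
      then have "x \<oplus> y \<in> Z" using CA[of Z] left_idealD(3)[of Z x y] by (simp add: \<A>_def)
      then show "x \<oplus> y \<in> \<Union>C" using Z by blast
    qed
    then show "\<Union>C \<in> \<A>" using C CA by (auto simp: \<A>_def)
  qed
  then obtain M where M: "M \<in> \<A>" "\<And>X. \<lbrakk>X \<in> \<A>; M \<subseteq> X\<rbrakk> \<Longrightarrow> X = M" by blast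
  have "maximal_left_ideal M R"
    unfolding maximal_left_ideal_def
  proof (intro conjI allI impI)
    show "left_ideal M R" "M \<noteq> carrier R" using M(1) by (auto simp: \<A>_def)
    fix J assume J: "left_ideal J R \<and> M \<subseteq> J"
    show "J = M \<or> J = carrier R"
    proof (cases "\<one> \<in> J")
      case True
      then show ?thesis using J left_ideal_eq_carrier_iff by blast
    next
      case False
      then show ?thesis using J M by (auto simp: \<A>_def)
    qed
  qed
  then show ?thesis using M(1) by (auto simp: \<A>_def)
qed

lemma maximal_left_idealD:
  assumes "maximal_left_ideal M R"
  shows "left_ideal M R" "\<one> \<notin> M" "\<lbrakk>left_ideal J R; M \<subseteq> J\<rbrakk> \<Longrightarrow> J = M \<or> J = carrier R"
  using assms left_ideal_eq_carrier_iff by (auto simp: maximal_left_ideal_def)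

lemma left_ideal_jacobson_radical: "left_ideal (jacobson_radical R) R"
  by (rule left_idealI)
    (auto simp: jacobson_radical_def dest: maximal_left_idealD(1) left_idealD)

text \<open>If \<open>1\<close> were not in the left annihilator of \<open>e\<close>, that left ideal would lie in a maximal one, which
  would contain both \<open>1 - e\<close> and \<open>e\<close>.\<close>

lemma idempotent_in_jacobson_radical:
  assumes e: "e \<in> jacobson_radical R" "e \<otimes> e = e"
  shows "e = \<zero>"
proof -
  have ec: "e \<in> carrier R" using e by (simp add: jacobson_radical_def)
  let ?I = "{x \<in> carrier R. x \<otimes> e = \<zero>}"
  have I: "left_ideal ?I R"
    by (rule left_idealI) (use ec in \<open>auto simp: l_distr m_assoc\<close>)
  have ne: "\<one> \<ominus> e \<in> ?I" using ec e by (simp add: minus_l_distr minus_eq_zero_iff)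
  have "\<one> \<in> ?I"
  proof (rule ccontr)
    assume "\<one> \<notin> ?I"
    then obtain M where M: "maximal_left_ideal M R" "?I \<subseteq> M"
      using exists_maximal_left_ideal[OF I] by blast
    then have "(\<one> \<ominus> e) \<oplus> e \<in> M"
      using ne e left_idealD(3)[OF maximal_left_idealD(1)[OF M(1)]]
      by (auto simp: jacobson_radical_def)
    moreover have "(\<one> \<ominus> e) \<oplus> e = \<one>" using ec by (intro minus_add_cancel) simp_all
    ultimately show False using maximal_left_idealD(2)[OF M(1)] by simp
  qed
  then show ?thesis using ec by simp
qed

text \<open>For \<open>r\<close> in the ring and \<open>M\<close> a maximal left ideal, \<open>{x. x r \<in> M}\<close> is either the whole ring or again a
  maximal left ideal. So it contains every \<open>a\<close> in the radical, that is, \<open>a r \<in> M\<close>.\<close>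

lemma ideal_jacobson_radical: "ideal (jacobson_radical R) R"
proof (rule idealI[OF ring_axioms])
  interpret left_ideal "jacobson_radical R" R by (rule left_ideal_jacobson_radical)
  show "subgroup (jacobson_radical R) (add_monoid R)" by (rule a_subgroup)
  show "x \<otimes> a \<in> jacobson_radical R" if "a \<in> jacobson_radical R" "x \<in> carrier R" for a x
    using that by (rule l_closed)
  fix a r assume a: "a \<in> jacobson_radical R" and r: "r \<in> carrier R"
  have ac: "a \<in> carrier R" using a by (simp add: jacobson_radical_def)
  have "a \<otimes> r \<in> M" if M: "maximal_left_ideal M R" for M
  proof (rule ccontr)
    assume ar: "a \<otimes> r \<notin> M"
    note MI = left_idealD[OF maximal_left_idealD(1)[OF M]]
    let ?Q = "{x \<in> carrier R. x \<otimes> r \<in> M}"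
    have Q: "left_ideal ?Q R"
      by (rule left_idealI) (use MI r in \<open>auto simp: l_distr m_assoc\<close>)
    have "maximal_left_ideal ?Q R"
      unfolding maximal_left_ideal_def
    proof (intro conjI allI impI Q)
      show "?Q \<noteq> carrier R" using ar ac by auto
      fix J assume J: "left_ideal J R \<and> ?Q \<subseteq> J"
      note JL = left_idealD[OF conjunct1[OF J]]
      show "J = ?Q \<or> J = carrier R"
      proof (cases "J \<subseteq> ?Q")
        case False
        then obtain j where j: "j \<in> J" "j \<otimes> r \<notin> M" using JL(1) by auto
        then have jc: "j \<in> carrier R" using JL(1) by auto
        let ?N = "{x \<otimes> (j \<otimes> r) \<oplus> m |x m. x \<in> carrier R \<and> m \<in> M}"
        have "left_ideal ?N R"
        proof (rule left_idealI)
          show "?N \<subseteq> carrier R" using jc r MI(1) by auto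
          show "\<zero> \<in> ?N" using jc r MI(2) by (auto intro!: exI[of _ \<zero>])
          fix x assume "x \<in> ?N"
          then obtain c m where c: "c \<in> carrier R" "m \<in> M" "x = c \<otimes> (j \<otimes> r) \<oplus> m" by auto
          have mc: "m \<in> carrier R" using c MI(1) by auto
          show "d \<otimes> x \<in> ?N" if d: "d \<in> carrier R" for d
          proof -
            have "d \<otimes> x = (d \<otimes> c) \<otimes> (j \<otimes> r) \<oplus> d \<otimes> m"
              using c d jc r mc by (simp add: r_distr m_assoc)
            then show ?thesis using c d MI(5) by blast
          qed
          fix y assume "y \<in> ?N"
          then obtain c' m' where c': "c' \<in> carrier R" "m' \<in> M" "y = c' \<otimes> (j \<otimes> r) \<oplus> m'" by auto
          have mc': "m' \<in> carrier R" using c' MI(1) by auto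
          have "x \<oplus> y = (c \<oplus> c') \<otimes> (j \<otimes> r) \<oplus> (m \<oplus> m')"
            using c c' jc r mc mc' by (simp add: l_distr a_ac)
          then show "x \<oplus> y \<in> ?N" using c c' MI(3) by blast
        qed
        moreover have "M \<subseteq> ?N"
        proof
          fix m assume "m \<in> M"
          moreover then have "m = \<zero> \<otimes> (j \<otimes> r) \<oplus> m" using MI(1) jc r by auto
          ultimately show "m \<in> ?N" by blast
        qed
        moreover have "j \<otimes> r \<in> ?N"
          using jc r MI(2) by simp (metis one_closed l_one m_closed r_zero)
        ultimately have N: "?N = carrier R" using maximal_left_idealD(3)[OF M] j by blast
        have "\<one> \<otimes> r \<in> ?N" using N r by simp
        then obtain c m where c: "c \<in> carrier R" "m \<in> M" "\<one> \<otimes> r = c \<otimes> (j \<otimes> r) \<oplus> m" by auto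
        have mc: "m \<in> carrier R" using c MI(1) by auto
        have "(\<one> \<ominus> c \<otimes> j) \<otimes> r = \<one> \<otimes> r \<ominus> c \<otimes> (j \<otimes> r)"
          using c jc r by (simp add: minus_l_distr m_assoc)
        also have "\<dots> = m"
        proof -
          have "c \<otimes> (j \<otimes> r) \<in> carrier R" using c jc r by simp
          then show ?thesis unfolding c(3) using mc by algebra
        qed
        finally have "\<one> \<ominus> c \<otimes> j \<in> ?Q" using c jc by simp
        then have "(\<one> \<ominus> c \<otimes> j) \<oplus> c \<otimes> j \<in> J" using J JL(3,5) c j by blast
        moreover have "(\<one> \<ominus> c \<otimes> j) \<oplus> c \<otimes> j = \<one>"
          using c jc by (intro minus_add_cancel) simp_all
        ultimately show ?thesis using J left_ideal_eq_carrier_iff by auto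
      qed (use J in auto)
    qed
    then show False using a ar ac by (auto simp: jacobson_radical_def)
  qed
  then show "a \<otimes> r \<in> jacobson_radical R" using ac r by (auto simp: jacobson_radical_def)
qed


end

section \<open>Left denominator sets of a left Artinian ring\<close>

text \<open>For \<open>e\<close> right semicentral these are the elements whose residue class modulo the ideal
  \<open>(1 - e) R\<close> is a unit; \<open>e a = e\<close> says that \<open>a\<close> is congruent to \<open>1\<close>.\<close>

definition units_mod :: "('a, 'b) ring_scheme \<Rightarrow> 'a \<Rightarrow> 'a set" where
  "units_mod R e = {t \<in> carrier R. \<exists>x\<in>carrier R.
     e \<otimes>\<^bsub>R\<^esub> (x \<otimes>\<^bsub>R\<^esub> t) = e \<and> e \<otimes>\<^bsub>R\<^esub> (t \<otimes>\<^bsub>R\<^esub> x) = e}"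

lemma left_artinian_minimal:
  assumes R: "left_artinian R" and \<F>: "\<And>I. I \<in> \<F> \<Longrightarrow> left_ideal I R" and I0: "I0 \<in> \<F>"
  shows "\<exists>I\<in>\<F>. \<forall>J\<in>\<F>. J \<subseteq> I \<longrightarrow> J = I"
proof (rule ccontr)
  assume "\<not> ?thesis"
  then have "\<forall>I\<in>\<F>. \<exists>J\<in>\<F>. J \<subset> I" by blast
  then obtain nxt where nxt: "\<And>I. I \<in> \<F> \<Longrightarrow> nxt I \<in> \<F> \<and> nxt I \<subset> I" by metis
  define c where "c n = (nxt ^^ n) I0" for n
  have c: "c n \<in> \<F>" for n by (induction n) (use I0 nxt in \<open>auto simp: c_def\<close>)
  then have "c (Suc n) \<subset> c n" for n using nxt by (simp add: c_def)
  moreover from this have "\<exists>N. \<forall>n\<ge>N. c n = c N"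
    using R \<F> c unfolding left_artinian_def by blast
  ultimately show False by (metis le_Suc_eq order_refl psubset_eq)
qed

context ring
begin

lemma left_ideal_principal:
  assumes "s \<in> carrier R"
  shows "left_ideal (carrier R #> s) R"
proof (rule left_idealI)
  show "carrier R #> s \<subseteq> carrier R" using assms by (auto simp: r_coset_def)
  show "\<zero> \<in> carrier R #> s" using assms by (auto simp: r_coset_def intro!: bexI[of _ \<zero>])
  fix x y assume "x \<in> carrier R #> s" "y \<in> carrier R #> s"
  then obtain a b where "a \<in> carrier R" "b \<in> carrier R" "x = a \<otimes> s" "y = b \<otimes> s"
    by (auto simp: r_coset_def)
  then have "x \<oplus> y = (a \<oplus> b) \<otimes> s" "a \<oplus> b \<in> carrier R" using assms by (auto simp: l_distr)
  then show "x \<oplus> y \<in> carrier R #> s" by (auto simp: r_coset_def)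
next
  fix x r assume "x \<in> carrier R #> s" "r \<in> carrier R"
  then obtain a where "a \<in> carrier R" "x = a \<otimes> s" by (auto simp: r_coset_def)
  then have "r \<otimes> x = (r \<otimes> a) \<otimes> s" "r \<otimes> a \<in> carrier R"
    using assms \<open>r \<in> carrier R\<close> by (auto simp: m_assoc)
  then show "r \<otimes> x \<in> carrier R #> s" by (auto simp: r_coset_def)
qed

lemma left_denominator_setD:
  assumes "left_denominator_set R S"
  shows "S \<subseteq> carrier R" "\<one> \<in> S" "\<zero> \<notin> S" "\<And>a b. \<lbrakk>a \<in> S; b \<in> S\<rbrakk> \<Longrightarrow> a \<otimes> b \<in> S"
    and "\<And>r s. \<lbrakk>r \<in> carrier R; s \<in> S\<rbrakk> \<Longrightarrow> \<exists>t\<in>S. \<exists>x\<in>carrier R. t \<otimes> r = x \<otimes> s"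
    and "\<And>r s. \<lbrakk>r \<in> carrier R; s \<in> S; r \<otimes> s = \<zero>\<rbrakk> \<Longrightarrow> \<exists>t\<in>S. t \<otimes> r = \<zero>"
proof -
  have S: "submonoid S R" "\<zero> \<notin> S"
    using assms by (auto simp: left_denominator_set_def left_ore_set_def multiplicative_set_def)
  then show "S \<subseteq> carrier R" "\<one> \<in> S" "\<zero> \<notin> S" "\<And>a b. \<lbrakk>a \<in> S; b \<in> S\<rbrakk> \<Longrightarrow> a \<otimes> b \<in> S"
    by (auto dest: submonoid.subset submonoid.one_closed intro: submonoid.m_closed)
  fix r s assume rs: "r \<in> carrier R" "s \<in> S"
  then have "(S #> r) \<inter> (carrier R #> s) \<noteq> {}"
    using assms by (auto simp: left_denominator_set_def left_ore_set_def)
  then show "\<exists>t\<in>S. \<exists>x\<in>carrier R. t \<otimes> r = x \<otimes> s"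
    by (fastforce simp: r_coset_def)
  show "\<exists>t\<in>S. t \<otimes> r = \<zero>" if "r \<otimes> s = \<zero>"
    using assms rs that by (auto simp: left_denominator_set_def)
qed

text \<open>All conditions can be met with the single denominator \<open>e\<close>, itself congruent to \<open>1\<close>: if \<open>x\<close> is
  an inverse of \<open>t\<close> modulo the ideal, then \<open>e r = (e r x) t\<close>, and \<open>r t = 0\<close> forces \<open>e r = e r t x = 0\<close>.\<close>

lemma left_denominator_set_units_mod:
  assumes e: "right_semicentral R e" and e0: "e \<noteq> \<zero>"
  shows "left_denominator_set R (units_mod R e)" "ass R (units_mod R e) = right_ann R e"
proof -
  have ec: "e \<in> carrier R" "e \<otimes> e = e" using e by (auto simp: right_semicentral_def)
  have absorb: "e \<otimes> (r \<otimes> (e \<otimes> x)) = e \<otimes> (r \<otimes> x)" if "r \<in> carrier R" "x \<in> carrier R" for r x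
  proof -
    have "e \<otimes> (r \<otimes> (e \<otimes> x)) = (e \<otimes> r \<otimes> e) \<otimes> x" using that ec by (simp add: m_assoc)
    also have "\<dots> = (e \<otimes> r) \<otimes> x" using that e by (simp add: right_semicentral_def)
    finally show ?thesis using that ec by (simp add: m_assoc)
  qed
  have absorb1: "e \<otimes> (r \<otimes> e) = e \<otimes> r" if "r \<in> carrier R" for r
    using absorb[OF that one_closed] that ec by simp
  have eU: "e \<in> units_mod R e"
    unfolding units_mod_def using ec by (auto intro!: bexI[of _ e])
  have U0: "\<zero> \<notin> units_mod R e" using e0 ec by (auto simp: units_mod_def)
  have sub: "submonoid (units_mod R e) R"
  proof
    show "units_mod R e \<subseteq> carrier R" by (auto simp: units_mod_def)
    show "\<one> \<in> units_mod R e" unfolding units_mod_def using ec by (auto intro!: bexI[of _ \<one>])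
    fix a b assume "a \<in> units_mod R e" "b \<in> units_mod R e"
    then obtain x y where ab: "a \<in> carrier R" "b \<in> carrier R"
      and x: "x \<in> carrier R" "e \<otimes> (x \<otimes> a) = e" "e \<otimes> (a \<otimes> x) = e"
      and y: "y \<in> carrier R" "e \<otimes> (y \<otimes> b) = e" "e \<otimes> (b \<otimes> y) = e"
      by (auto simp: units_mod_def)
    have cancel: "e \<otimes> ((p \<otimes> q) \<otimes> (q' \<otimes> p')) = e"
      if "p \<in> carrier R" "q \<in> carrier R" "q' \<in> carrier R" "p' \<in> carrier R"
        "e \<otimes> (q \<otimes> q') = e" "e \<otimes> (p \<otimes> p') = e" for p q q' p'
    proof -
      have "e \<otimes> ((p \<otimes> q) \<otimes> (q' \<otimes> p')) = e \<otimes> (p \<otimes> (e \<otimes> (q \<otimes> (q' \<otimes> p'))))"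
        using that ec absorb[of p "q \<otimes> (q' \<otimes> p')"] by (simp add: m_assoc)
      also have "e \<otimes> (q \<otimes> (q' \<otimes> p')) = e \<otimes> (q \<otimes> q') \<otimes> p'" using that(1-4) ec by (simp add: m_assoc)
      also have "\<dots> = e \<otimes> p'" using that by simp
      finally show ?thesis using that ec absorb[of p p'] by simp
    qed
    show "a \<otimes> b \<in> units_mod R e"
      unfolding units_mod_def using ab x y cancel[of y x a b] cancel[of a b y x]
      by (auto intro!: bexI[of _ "y \<otimes> x"])
  qed
  have ore: "(units_mod R e #> r) \<inter> (carrier R #> t) \<noteq> {}"
    if r: "r \<in> carrier R" and "t \<in> units_mod R e" for r t
  proof -
    obtain x where x: "t \<in> carrier R" "x \<in> carrier R" "e \<otimes> (x \<otimes> t) = e"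
      using \<open>t \<in> units_mod R e\<close> by (auto simp: units_mod_def)
    have "e \<otimes> r \<otimes> x \<otimes> t = e \<otimes> (r \<otimes> (x \<otimes> t))" using r x ec by (simp add: m_assoc)
    also have "\<dots> = e \<otimes> (r \<otimes> (e \<otimes> (x \<otimes> t)))"
      using r x by (intro absorb[symmetric]) simp_all
    also have "\<dots> = e \<otimes> r" using r x absorb1 by simp
    finally have "e \<otimes> r = (e \<otimes> r \<otimes> x) \<otimes> t" ..
    moreover have "e \<otimes> r \<otimes> x \<in> carrier R" using r x ec by simp
    ultimately have "e \<otimes> r \<in> (units_mod R e #> r) \<inter> (carrier R #> t)"
      using eU unfolding r_coset_def by blast
    then show ?thesis by blast
  qed
  have den: "\<exists>t'\<in>units_mod R e. t' \<otimes> r = \<zero>"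
    if r: "r \<in> carrier R" and "t \<in> units_mod R e" "r \<otimes> t = \<zero>" for r t
  proof -
    obtain x where x: "t \<in> carrier R" "x \<in> carrier R" "e \<otimes> (t \<otimes> x) = e"
      using \<open>t \<in> units_mod R e\<close> by (auto simp: units_mod_def)
    have "e \<otimes> r = e \<otimes> (r \<otimes> (e \<otimes> (t \<otimes> x)))" using r x absorb1 by simp
    also have "\<dots> = e \<otimes> (r \<otimes> (t \<otimes> x))" using r x by (intro absorb) simp_all
    also have "\<dots> = e \<otimes> (r \<otimes> t) \<otimes> x" using r x ec by (simp add: m_assoc)
    also have "\<dots> = \<zero>" using that x ec by simp
    finally show ?thesis using eU by blast
  qed
  show "left_denominator_set R (units_mod R e)"
    using sub U0 ore den
    by (auto simp: left_denominator_set_def left_ore_set_def multiplicative_set_def)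
  show "ass R (units_mod R e) = right_ann R e"
  proof
    show "right_ann R e \<subseteq> ass R (units_mod R e)" using eU by (auto simp: right_ann_def ass_def)
    show "ass R (units_mod R e) \<subseteq> right_ann R e"
    proof
      fix r assume "r \<in> ass R (units_mod R e)"
      then obtain t x where r: "r \<in> carrier R" "t \<otimes> r = \<zero>"
        and x: "t \<in> carrier R" "x \<in> carrier R" "e \<otimes> (x \<otimes> t) = e"
        by (auto simp: ass_def units_mod_def)
      have "e \<otimes> r = e \<otimes> (x \<otimes> t) \<otimes> r" using x by simp
      also have "\<dots> = e \<otimes> (x \<otimes> (t \<otimes> r))" using r(1) x(1,2) ec by (simp add: m_assoc)
      finally show "r \<in> right_ann R e" using r x ec by (simp add: right_ann_def)
    qed
  qed
qed

lemma units_mod_mono: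
  assumes e: "e \<in> carrier R" and f: "f \<in> carrier R" and sub: "right_ann R e \<subseteq> right_ann R f"
  shows "units_mod R e \<subseteq> units_mod R f"
proof -
  have *: "f \<otimes> a = f" if "a \<in> carrier R" "e \<otimes> a = e" for a
  proof -
    have "a \<ominus> \<one> \<in> right_ann R e"
      using that e by (simp add: right_ann_def minus_r_distr minus_eq_zero_iff)
    then have "f \<otimes> (a \<ominus> \<one>) = \<zero>" using sub by (auto simp: right_ann_def)
    then show ?thesis using that f by (simp add: minus_r_distr minus_eq_zero_iff)
  qed
  show ?thesis
    unfolding units_mod_def using * by blast
qed

text \<open>The chain condition provides \<open>s \<in> S\<close> with \<open>R s\<close> minimal. Such an \<open>s\<close> is a left multiple of every
  element of \<open>S\<close>. Hence \<open>ass(S)\<close>, a union of annihilators, is the annihilator of \<open>s\<close> alone; and \<open>s\<close> being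
  a left multiple of \<open>s s\<close> produces the idempotent.\<close>

lemma left_denominator_set_idempotent:
  assumes R: "left_artinian R" and S: "left_denominator_set R S"
  obtains e where "right_semicentral R e" "e \<noteq> \<zero>" "ass R S = right_ann R e"
    "S \<subseteq> units_mod R e"
proof -
  note SD = left_denominator_setD[OF S]
  have "\<exists>I\<in>(\<lambda>s. carrier R #> s) ` S. \<forall>J\<in>(\<lambda>s. carrier R #> s) ` S. J \<subseteq> I \<longrightarrow> J = I"
    by (rule left_artinian_minimal[OF R]) (use SD left_ideal_principal in blast)+
  then obtain s where s: "s \<in> S"
    and min: "\<And>t. \<lbrakk>t \<in> S; carrier R #> t \<subseteq> carrier R #> s\<rbrakk> \<Longrightarrow> carrier R #> t = carrier R #> s"
    by auto
  have sc: "s \<in> carrier R" using s SD by auto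
  \<comment> \<open>By the Ore condition some \<open>s' t\<close> lies in \<open>R s\<close>, and then \<open>R (s' t) = R s\<close> by minimality.\<close>
  have least: "\<exists>z\<in>carrier R. s = z \<otimes> t" if t: "t \<in> S" for t
  proof -
    have tc: "t \<in> carrier R" using t SD by auto
    obtain s' x where x: "s' \<in> S" "x \<in> carrier R" "s' \<otimes> t = x \<otimes> s"
      using SD(5)[OF tc s] by blast
    have s'c: "s' \<in> carrier R" using x SD by auto
    have "carrier R #> (s' \<otimes> t) \<subseteq> carrier R #> s"
    proof
      fix y assume "y \<in> carrier R #> (s' \<otimes> t)"
      then obtain a where a: "a \<in> carrier R" "y = a \<otimes> (x \<otimes> s)"
        using x by (auto simp: r_coset_def)
      then have "y = (a \<otimes> x) \<otimes> s" using x sc by (simp add: m_assoc)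
      then show "y \<in> carrier R #> s" using a x by (auto simp: r_coset_def)
    qed
    then have "carrier R #> (s' \<otimes> t) = carrier R #> s" using min SD(4) x t by blast
    moreover have "\<one> \<otimes> s \<in> carrier R #> s" unfolding r_coset_def by blast
    ultimately obtain z where "z \<in> carrier R" "s = z \<otimes> (s' \<otimes> t)"
      using sc by (auto simp: r_coset_def)
    then have "z \<otimes> s' \<in> carrier R" "s = (z \<otimes> s') \<otimes> t" using s'c tc by (auto simp: m_assoc)
    then show ?thesis by blast
  qed
  have kill: "s \<otimes> a = \<zero>" if a: "a \<in> carrier R" "t \<in> S" "t \<otimes> a = \<zero>" for a t
  proof -
    obtain z where z: "z \<in> carrier R" "s = z \<otimes> t" using least a by blast
    have "s \<otimes> a = z \<otimes> (t \<otimes> a)" using z a SD(1) by (auto simp: m_assoc)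
    then show ?thesis using a z by simp
  qed
  have rkill: "s \<otimes> a = \<zero>" if a: "a \<in> carrier R" "t \<in> S" "a \<otimes> t = \<zero>" for a t
    using SD(6)[OF a] kill a by blast
  obtain y where y: "y \<in> carrier R" "s = y \<otimes> (s \<otimes> s)"
    using least[of "s \<otimes> s"] SD(4) s by blast
  define e where "e = y \<otimes> s"
  have ec: "e \<in> carrier R" using y(1) sc by (simp add: e_def)
  have "e \<otimes> s = s" using m_assoc[OF y(1) sc sc] y(2) by (simp only: e_def)
  then have "(\<one> \<ominus> e) \<otimes> s = \<zero>" using sc ec by (simp add: minus_l_distr minus_eq_zero_iff)
  then have "s \<otimes> (\<one> \<ominus> e) = \<zero>" by (intro rkill[OF _ s]) (use ec in simp_all)
  then have se: "s \<otimes> e = s" using sc ec by (simp add: minus_r_distr minus_eq_zero_iff)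
  have ee: "e \<otimes> e = e"
  proof -
    have "e \<otimes> e = y \<otimes> (s \<otimes> e)" using y(1) sc ec by (simp add: e_def m_assoc)
    then show ?thesis using se by (simp add: e_def)
  qed
  have zero_iff: "e \<otimes> a = \<zero> \<longleftrightarrow> s \<otimes> a = \<zero>" if a: "a \<in> carrier R" for a
  proof
    assume "e \<otimes> a = \<zero>"
    then have "s \<otimes> (e \<otimes> a) = \<zero>" using sc by simp
    then show "s \<otimes> a = \<zero>" using se a ec sc by (simp flip: m_assoc)
  next
    assume "s \<otimes> a = \<zero>"
    then show "e \<otimes> a = \<zero>" using y(1) sc a by (simp add: e_def m_assoc)
  qed
  have ass: "ass R S = right_ann R e"
    using s kill zero_iff by (auto simp: ass_def right_ann_def)
  \<comment> \<open>The Ore condition shows that \<open>ass(S)\<close>, which contains \<open>1 - e\<close>, is stable under left multiplication.\<close>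
  have semi: "e \<otimes> r \<otimes> e = e \<otimes> r" if r: "r \<in> carrier R" for r
  proof -
    obtain t x where t: "t \<in> S" "x \<in> carrier R" "t \<otimes> r = x \<otimes> s" using SD(5)[OF r s] by blast
    have tc: "t \<in> carrier R" using t SD by auto
    have "t \<otimes> (r \<otimes> (\<one> \<ominus> e)) = x \<otimes> (s \<otimes> (\<one> \<ominus> e))"
      using t tc r ec sc by (simp flip: m_assoc)
    then have "t \<otimes> (r \<otimes> (\<one> \<ominus> e)) = \<zero>" using se sc ec t by (simp add: minus_r_distr minus_eq_zero_iff)
    then have "s \<otimes> (r \<otimes> (\<one> \<ominus> e)) = \<zero>" by (intro kill[OF _ t(1)]) (use r ec in simp_all)
    then have "e \<otimes> (r \<otimes> (\<one> \<ominus> e)) = \<zero>" using zero_iff r ec by simp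
    then have "e \<otimes> r = e \<otimes> (r \<otimes> e)"
      using r ec by (simp add: minus_r_distr minus_eq_zero_iff)
    moreover have "e \<otimes> r \<otimes> e = e \<otimes> (r \<otimes> e)" using r ec by (simp add: m_assoc)
    ultimately show ?thesis by simp
  qed
  have sub: "S \<subseteq> units_mod R e"
  proof
    fix t assume t: "t \<in> S"
    then have tc: "t \<in> carrier R" using SD by auto
    obtain z where z: "z \<in> carrier R" "s = z \<otimes> t" using least t by blast
    define x where "x = y \<otimes> z"
    have x: "x \<in> carrier R" "x \<otimes> t = e" using y(1) z tc by (auto simp: x_def e_def m_assoc)
    \<comment> \<open>A left inverse \<open>x\<close> of \<open>t\<close> is also a right inverse, since right factors in \<open>S\<close> cancel modulo \<open>ass(S)\<close>.\<close>
    have "(e \<otimes> (t \<otimes> x) \<ominus> e) \<otimes> t = e \<otimes> t \<otimes> e \<ominus> e \<otimes> t"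
      using x tc ec by (simp add: minus_l_distr m_assoc)
    also have "\<dots> = \<zero>" using semi tc ec by (simp add: minus_eq_zero_iff)
    finally have "s \<otimes> (e \<otimes> (t \<otimes> x) \<ominus> e) = \<zero>"
      by (intro rkill[OF _ t]) (use x tc ec in simp_all)
    then have "e \<otimes> (e \<otimes> (t \<otimes> x) \<ominus> e) = \<zero>" using zero_iff x tc ec by simp
    then have "e \<otimes> (t \<otimes> x) = e"
      using x tc ec ee by (simp add: minus_r_distr minus_eq_zero_iff flip: m_assoc)
    then show "t \<in> units_mod R e" unfolding units_mod_def using x tc ee by auto
  qed
  have "e \<noteq> \<zero>" using se sc s SD(3) by auto
  then show ?thesis using that[of e] ec ee semi ass sub by (auto simp: right_semicentral_def)
qed

end

section \<open>Simple components of a quotient ring\<close>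

lemma zero_FactRing: "\<zero>\<^bsub>R Quot J\<^esub> = J"
  by (simp add: FactRing_def)

lemma carrier_FactRing_cosetE:
  assumes "x \<in> carrier (R Quot J)"
  obtains a where "a \<in> carrier R" "x = J +>\<^bsub>R\<^esub> a"
  using assms by (auto simp: FactRing_def A_RCOSETS_def')

text \<open>The residue classes of \<open>A\<close> that lie in the simple component \<open>B\<close> form an ideal of \<open>B\<close>, which is
  zero or contains the identity of \<open>B\<close>.\<close>

lemma (in ring) simple_component_dichotomy:
  assumes J: "ideal J R" and A: "ideal A R" and u: "u \<in> carrier R"
    and B: "ideal B (R Quot J)"
    and simple: "simple_ring ((R Quot J)\<lparr>carrier := B, one := J +> u\<rparr>)"
  shows "(\<exists>a\<in>A. u \<ominus> a \<in> J) \<or> (\<forall>a\<in>A. u \<otimes> a \<in> J)"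
proof -
  let ?Q = "R Quot J" and ?K = "(R Quot J)\<lparr>carrier := B, one := J +> u\<rparr>"
  interpret J: ideal J R by (rule J)
  interpret A: ideal A R by (rule A)
  interpret B: ideal B ?Q by (rule B)
  interpret h: ring_hom_ring R ?Q "(+>) J" by (rule J.rcos_ring_hom_ring)
  have K: "ring ?K" using simple unfolding simple_ring_def by (rule conjunct1)
  have zeroQ: "\<zero>\<^bsub>?Q\<^esub> = J" by (rule zero_FactRing)
  have coset: "J +> a = J \<longleftrightarrow> a \<in> J" if a: "a \<in> carrier R" for a
  proof -
    have "a \<ominus> \<zero> = a" using a by algebra
    moreover have "J +> \<zero> = J" using h.hom_zero by (simp only: zeroQ)
    ultimately show ?thesis using quotient_eq_iff_same_a_r_cos[OF J a zero_closed] by simp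
  qed
  have uB: "J +> u \<in> B" using monoid.one_closed[OF ring.is_monoid[OF K]] by simp
  define C where "C = {x \<in> B. \<exists>a\<in>A. x = J +> a}"
  have CI: "J +> a \<in> C" if "J +> a \<in> B" "a \<in> A" for a using that by (auto simp: C_def)
  have C: "left_ideal C ?K"
  proof (rule ring.left_idealI[OF K])
    show "C \<subseteq> carrier ?K" by (auto simp: C_def)
    show "\<zero>\<^bsub>?K\<^esub> \<in> C" using CI[of \<zero>] B.zero_closed h.hom_zero by simp
    fix x y assume "x \<in> C" "y \<in> C"
    then obtain a b where "x \<in> B" "y \<in> B" "a \<in> A" "b \<in> A" "x = J +> a" "y = J +> b"
      by (auto simp: C_def)
    then show "x \<oplus>\<^bsub>?K\<^esub> y \<in> C"
      using CI[of "a \<oplus> b"] B.a_closed[of x y] by (simp add: h.hom_add)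
  next
    fix x r assume x: "x \<in> C" "r \<in> carrier ?K"
    then obtain a where a: "x \<in> B" "a \<in> A" "x = J +> a" by (auto simp: C_def)
    have "r \<in> carrier ?Q" using x by simp
    then obtain c where c: "c \<in> carrier R" "r = J +> c" by (rule carrier_FactRing_cosetE)
    then show "r \<otimes>\<^bsub>?K\<^esub> x \<in> C"
      using CI[of "c \<otimes> a"] a B.I_l_closed[of x r] A.I_l_closed[of a c] by (simp add: h.hom_mult)
  qed
  have "ideal C ?K"
  proof (rule idealI[OF K additive_subgroup.a_subgroup[OF left_ideal.axioms(1)[OF C]]])
    show "x \<otimes>\<^bsub>?K\<^esub> a \<in> C" if "a \<in> C" "x \<in> carrier ?K" for a x using that by (rule left_ideal.l_closed[OF C])
    fix x r assume x: "x \<in> C" "r \<in> carrier ?K"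
    then obtain a where a: "x \<in> B" "a \<in> A" "x = J +> a" by (auto simp: C_def)
    have "r \<in> carrier ?Q" using x by simp
    then obtain c where c: "c \<in> carrier R" "r = J +> c" by (rule carrier_FactRing_cosetE)
    then show "x \<otimes>\<^bsub>?K\<^esub> r \<in> C"
      using CI[of "a \<otimes> c"] a B.I_r_closed[of x r] A.I_r_closed[of a c] by (simp add: h.hom_mult)
  qed
  then have "C = {\<zero>\<^bsub>?K\<^esub>} \<or> C = carrier ?K" using simple unfolding simple_ring_def by blast
  then show ?thesis
  proof
    assume C: "C = {\<zero>\<^bsub>?K\<^esub>}"
    have "u \<otimes> a \<in> J" if a: "a \<in> A" for a
    proof -
      have "J +> (u \<otimes> a) \<in> B"
        using a u uB B.I_r_closed[of "J +> u" "J +> a"] by (simp add: h.hom_mult)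
      then have "J +> (u \<otimes> a) \<in> C" by (rule CI) (use a u A.I_l_closed in blast)
      then show ?thesis using C zeroQ coset[of "u \<otimes> a"] a u by simp
    qed
    then show ?thesis by blast
  next
    assume "C = carrier ?K"
    then obtain a where "a \<in> A" "J +> u = J +> a" using uB by (auto simp: C_def)
    then show ?thesis using quotient_eq_iff_same_a_r_cos[OF J u, of a] by auto
  qed
qed

section \<open>Sums over sets of indices\<close>

text \<open>Since the \<open>u i\<close> are nonzero, a subset \<open>I\<close> of \<open>{1..s}\<close> is determined by the idempotent \<open>E I\<close>,
  and the posets of idempotents can be handled as families of index sets.\<close>

locale complete_idempotents = ring +
  fixes s :: nat and u :: "nat \<Rightarrow> 'a"
  assumes u_closed: "\<And>i. i \<in> {1..s} \<Longrightarrow> u i \<in> carrier R"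
    and u_idem: "\<And>i. i \<in> {1..s} \<Longrightarrow> u i \<otimes> u i = u i"
    and u_orth: "\<And>i j. \<lbrakk>i \<in> {1..s}; j \<in> {1..s}; i \<noteq> j\<rbrakk> \<Longrightarrow> u i \<otimes> u j = \<zero>"
    and u_sum: "(\<Oplus>i\<in>{1..s}. u i) = \<one>"
    and u_nonzero: "\<And>i. i \<in> {1..s} \<Longrightarrow> u i \<noteq> \<zero>"
begin

\<comment> \<open>Otherwise \<open>{1..s}\<close> is rewritten to \<open>{Suc 0..s}\<close>, where \<open>E_full\<close> no longer applies.\<close>
declare One_nat_def [simp del]

abbreviation E :: "nat set \<Rightarrow> 'a" where "E \<equiv> idem_sum R u"

definition absorbing :: "nat set \<Rightarrow> bool" where
  "absorbing I \<longleftrightarrow> I \<subseteq> {1..s} \<and> I \<noteq> {} \<and> right_semicentral R (E I)"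

definition minimal_absorbing :: "nat set \<Rightarrow> bool" where
  "minimal_absorbing I \<longleftrightarrow> absorbing I \<and> (\<forall>J. absorbing J \<and> J \<subseteq> I \<longrightarrow> J = I)"

lemma u_Pi: "u \<in> {1..s} \<rightarrow> carrier R"
  using u_closed by blast

lemma E_closed [simp]: "I \<subseteq> {1..s} \<Longrightarrow> E I \<in> carrier R"
  unfolding idem_sum_def using u_closed by (intro finsum_closed) blast

lemma E_empty [simp]: "E {} = \<zero>"
  by (simp add: idem_sum_def)

lemma E_full [simp]: "E {1..s} = \<one>"
  using u_sum by (simp add: idem_sum_def)

lemma E_mult: "\<lbrakk>I \<subseteq> {1..s}; J \<subseteq> {1..s}\<rbrakk> \<Longrightarrow> E I \<otimes> E J = E (I \<inter> J)"
  unfolding idem_sum_def by (rule orthogonal_sum_mult[of "{1..s}"]) (use u_Pi u_idem u_orth in auto)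

lemma u_E: "\<lbrakk>i \<in> {1..s}; J \<subseteq> {1..s}\<rbrakk> \<Longrightarrow> u i \<otimes> E J = (if i \<in> J then u i else \<zero>)"
  unfolding idem_sum_def by (rule orthogonal_sum_absorb[of "{1..s}"]) (use u_Pi u_idem u_orth in auto)

lemma E_compl:
  assumes I: "I \<subseteq> {1..s}"
  shows "\<one> \<ominus> E I = E ({1..s} - I)"
proof -
  have fin: "finite I" using I finite_subset by blast
  have "E (I \<union> ({1..s} - I)) = E I \<oplus> E ({1..s} - I)"
    unfolding idem_sum_def using I fin u_closed by (intro finsum_Un_disjoint) auto
  moreover have "I \<union> ({1..s} - I) = {1..s}" using I by blast
  ultimately have "\<one> = E I \<oplus> E ({1..s} - I)" by (simp only: E_full)
  moreover have "E I \<oplus> E ({1..s} - I) \<ominus> E I = E ({1..s} - I)"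
  proof -
    have "E I \<in> carrier R" "E ({1..s} - I) \<in> carrier R" using I by auto
    then show ?thesis by algebra
  qed
  ultimately show ?thesis by simp
qed

lemma E_absorb_iff:
  assumes I: "I \<subseteq> {1..s}" and J: "J \<subseteq> {1..s}"
  shows "E I \<otimes> E J = E I \<longleftrightarrow> I \<subseteq> J"
proof
  assume eq: "E I \<otimes> E J = E I"
  show "I \<subseteq> J"
  proof
    fix i assume i: "i \<in> I"
    then have ia: "i \<in> {1..s}" using I by blast
    have "u i \<otimes> (E I \<otimes> E J) = u i \<otimes> E I \<otimes> E J" using I J ia u_closed by (simp add: m_assoc)
    then have "u i = u i \<otimes> E J" using eq u_E[OF ia I] i by simp
    then show "i \<in> J" using u_E[OF ia J] u_nonzero[OF ia] by (auto split: if_splits)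
  qed
next
  assume "I \<subseteq> J"
  then show "E I \<otimes> E J = E I" using I J by (simp add: E_mult Int_absorb2)
qed

lemma E_inj: "inj_on E (Pow {1..s})"
proof (rule inj_onI)
  fix I J assume IJ: "I \<in> Pow {1..s}" "J \<in> Pow {1..s}" "E I = E J"
  then have "E (I \<inter> J) = E I" "E (J \<inter> I) = E J"
    using E_mult[of I I] E_mult[of J J] E_mult[of I J] E_mult[of J I] by simp_all
  then have "E I \<otimes> E J = E I" "E J \<otimes> E I = E J" using IJ(1,2) E_mult by simp_all
  then have "I \<subseteq> J" "J \<subseteq> I" using IJ(1,2) E_absorb_iff by blast+
  then show "I = J" ..
qed

lemma E_eq_iff: "\<lbrakk>I \<subseteq> {1..s}; J \<subseteq> {1..s}\<rbrakk> \<Longrightarrow> E I = E J \<longleftrightarrow> I = J"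
  using inj_on_eq_iff[OF E_inj] by blast

lemma idem_le_E_iff:
  assumes I: "I \<subseteq> {1..s}" and J: "J \<subseteq> {1..s}"
  shows "idem_le R u s (E J) (E I) \<longleftrightarrow> J \<subseteq> I"
proof
  assume "idem_le R u s (E J) (E I)"
  then obtain I' J' where "I' \<subseteq> {1..s}" "J' \<subseteq> I'" "E I = E I'" "E J = E J'"
    by (auto simp: idem_le_def)
  moreover from this have "I = I'" "J = J'" using E_eq_iff[OF I] E_eq_iff[OF J] by blast+
  ultimately show "J \<subseteq> I" by simp
next
  assume "J \<subseteq> I"
  then show "idem_le R u s (E J) (E I)" unfolding idem_le_def using I by blast
qed

lemma absorbingD:
  assumes "absorbing I"
  shows "I \<subseteq> {1..s}" "I \<noteq> {}" "right_semicentral R (E I)"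
  using assms by (auto simp: absorbing_def)

lemma minimal_absorbingD:
  assumes "minimal_absorbing I"
  shows "absorbing I" "I \<subseteq> {1..s}" "I \<noteq> {}" "right_semicentral R (E I)"
    "\<lbrakk>absorbing J; J \<subseteq> I\<rbrakk> \<Longrightarrow> J = I"
  using assms by (auto simp: minimal_absorbing_def absorbing_def)

lemma E_idem: "I \<subseteq> {1..s} \<Longrightarrow> E I \<otimes> E I = E I"
  by (simp add: E_mult)

lemma peirce_E_iff: "I \<subseteq> {1..s} \<Longrightarrow> peirce R (E I) (\<one> \<ominus> E I) = {\<zero>} \<longleftrightarrow> right_semicentral R (E I)"
  by (rule peirce_compl_trivial_iff) (auto simp: E_idem)

lemma I_l'_eq: "I_l' R u s = E ` {I. absorbing I}"
  unfolding I_l'_def absorbing_def using peirce_E_iff by blast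

lemma min_I_l'_eq: "min_I_l' R u s = E ` {I. minimal_absorbing I}"
proof -
  have "E I \<in> min_I_l' R u s \<longleftrightarrow> minimal_absorbing I" if I: "absorbing I" for I
    unfolding min_I_l'_def I_l'_eq minimal_absorbing_def
    using I absorbingD(1) idem_le_E_iff E_eq_iff by auto
  moreover have "min_I_l' R u s \<subseteq> E ` {I. absorbing I}" by (auto simp: min_I_l'_def I_l'_eq)
  ultimately show ?thesis by (auto simp: minimal_absorbing_def)
qed

lemma I_r''_eq: "I_r'' R u s = (\<lambda>I. E ({1..s} - I)) ` {I. absorbing I \<and> I \<noteq> {1..s}}"
proof -
  have *: "peirce R (\<one> \<ominus> E J) (E J) = {\<zero>} \<longleftrightarrow> right_semicentral R (E ({1..s} - J))"
    if J: "J \<subseteq> {1..s}" for J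
  proof -
    have "{1..s} - ({1..s} - J) = J" using J by blast
    then have "E J = \<one> \<ominus> E ({1..s} - J)" using E_compl[of "{1..s} - J"] by simp
    then show ?thesis using peirce_E_iff[of "{1..s} - J"] E_compl[OF J] by simp
  qed
  show ?thesis
  proof (intro subset_antisym subsetI)
    fix e assume "e \<in> I_r'' R u s"
    then obtain J where J: "e = E J" "J \<noteq> {}" "J \<subset> {1..s}" "peirce R (\<one> \<ominus> E J) (E J) = {\<zero>}"
      by (auto simp: I_r''_def)
    then have "absorbing ({1..s} - J)" using *[of J] by (auto simp: absorbing_def)
    moreover have "{1..s} - J \<noteq> {1..s}" "{1..s} - ({1..s} - J) = J" using J by auto
    ultimately show "e \<in> (\<lambda>I. E ({1..s} - I)) ` {I. absorbing I \<and> I \<noteq> {1..s}}"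
      using J(1) by (intro image_eqI[of _ _ "{1..s} - J"]) simp_all
  next
    fix e assume "e \<in> (\<lambda>I. E ({1..s} - I)) ` {I. absorbing I \<and> I \<noteq> {1..s}}"
    then obtain I where I: "e = E ({1..s} - I)" "absorbing I" "I \<noteq> {1..s}" by auto
    have "{1..s} - ({1..s} - I) = I" using absorbingD(1)[OF I(2)] by blast
    then have "peirce R (\<one> \<ominus> e) e = {\<zero>}"
      using *[of "{1..s} - I"] absorbingD(3)[OF I(2)] I(1) by simp
    moreover have "{1..s} - I \<noteq> {}" "{1..s} - I \<subset> {1..s}"
      using I(3) absorbingD(1,2)[OF I(2)] by blast+
    ultimately show "e \<in> I_r'' R u s" unfolding I_r''_def I(1) by blast
  qed
qed

text \<open>Complementation reverses inclusion and exchanges the conditions \<open>e R (1 - e) = 0\<close> and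
  \<open>(1 - f) R f = 0\<close>. The full index set is left out because its complement is empty.\<close>

lemma max_I_r''_eq:
  "max_I_r'' R u s = (\<lambda>I. E ({1..s} - I)) ` {I. minimal_absorbing I \<and> I \<noteq> {1..s}}"
proof -
  have compl: "{1..s} - I \<subseteq> {1..s} - K \<longleftrightarrow> K \<subseteq> I" "E ({1..s} - K) = E ({1..s} - I) \<longleftrightarrow> K = I"
    if "absorbing I" "absorbing K" for I K
    using absorbingD(1)[OF that(1)] absorbingD(1)[OF that(2)]
      E_eq_iff[of "{1..s} - K" "{1..s} - I"] by blast+
  have "E ({1..s} - I) \<in> max_I_r'' R u s \<longleftrightarrow> minimal_absorbing I"
    if I: "absorbing I" "I \<noteq> {1..s}" for I
  proof -
    have "E ({1..s} - I) \<in> max_I_r'' R u s \<longleftrightarrow>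
        (\<forall>K. absorbing K \<and> K \<noteq> {1..s} \<longrightarrow> K \<subseteq> I \<longrightarrow> K = I)"
      unfolding max_I_r''_def I_r''_eq using I compl
      by (auto simp: idem_le_E_iff)
    also have "\<dots> \<longleftrightarrow> minimal_absorbing I"
      unfolding minimal_absorbing_def using I absorbingD(1)[OF I(1)] by blast
    finally show ?thesis .
  qed
  moreover have "max_I_r'' R u s \<subseteq> (\<lambda>I. E ({1..s} - I)) ` {I. absorbing I \<and> I \<noteq> {1..s}}"
    by (auto simp: max_I_r''_def I_r''_eq)
  ultimately show ?thesis by (fastforce simp: minimal_absorbing_def)
qed

lemma exists_minimal_absorbing:
  assumes "absorbing I"
  obtains J where "minimal_absorbing J" "J \<subseteq> I"
proof -
  have "finite {J. absorbing J \<and> J \<subseteq> I}"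
    by (rule finite_subset[of _ "Pow {1..s}"]) (auto dest: absorbingD(1))
  from finite_has_minimal2[OF this, of I] assms
  obtain J where "absorbing J" "J \<subseteq> I" "\<And>K. \<lbrakk>absorbing K; K \<subseteq> I; K \<subseteq> J\<rbrakk> \<Longrightarrow> J = K" by auto
  then have "minimal_absorbing J" unfolding minimal_absorbing_def by blast
  then show ?thesis using that \<open>J \<subseteq> I\<close> by blast
qed

lemma absorbing_full: "{1..s} \<noteq> {} \<Longrightarrow> absorbing {1..s}"
  by (simp add: absorbing_def right_semicentral_def)

text \<open>This is why distinct minimal index sets are disjoint: \<open>E I\<close> and \<open>E J\<close> commute, so each of
  them can absorb its own copy on the right.\<close>

lemma absorbing_Int:
  assumes I: "absorbing I" and J: "absorbing J" and ne: "I \<inter> J \<noteq> {}"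
  shows "absorbing (I \<inter> J)"
proof -
  note sub = absorbingD(1)[OF I] absorbingD(1)[OF J]
  have int: "I \<inter> J \<subseteq> {1..s}" using sub by blast
  have "E (I \<inter> J) \<otimes> r \<otimes> E (I \<inter> J) = E (I \<inter> J) \<otimes> r" if r: "r \<in> carrier R" for r
  proof -
    have c: "E I \<in> carrier R" "E J \<in> carrier R" using sub by auto
    have IJ: "E (I \<inter> J) = E I \<otimes> E J" "E (I \<inter> J) = E J \<otimes> E I"
      using E_mult[OF sub] E_mult[OF sub(2,1)] by (simp_all add: Int_commute)
    have "E (I \<inter> J) \<otimes> r \<otimes> E (I \<inter> J) = E J \<otimes> (E I \<otimes> r \<otimes> E I) \<otimes> E J"
    proof -
      have "E (I \<inter> J) \<otimes> r \<otimes> E (I \<inter> J) = (E J \<otimes> E I) \<otimes> r \<otimes> (E I \<otimes> E J)"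
        by (simp only: IJ(2)[symmetric] IJ(1)[symmetric])
      then show ?thesis using c r by (simp add: m_assoc)
    qed
    also have "\<dots> = E J \<otimes> (E I \<otimes> r) \<otimes> E J"
      using absorbingD(3)[OF I] r by (simp add: right_semicentral_def)
    also have "\<dots> = E I \<otimes> (E J \<otimes> r \<otimes> E J)"
    proof -
      have "E J \<otimes> (E I \<otimes> r) \<otimes> E J = (E J \<otimes> E I) \<otimes> (r \<otimes> E J)" using c r by (simp add: m_assoc)
      also have "E J \<otimes> E I = E I \<otimes> E J" using IJ by simp
      finally show ?thesis using c r by (simp add: m_assoc)
    qed
    also have "\<dots> = E I \<otimes> (E J \<otimes> r)"
      using absorbingD(3)[OF J] r by (simp add: right_semicentral_def)
    also have "\<dots> = E (I \<inter> J) \<otimes> r" using c r by (simp add: IJ(1) m_assoc)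
    finally show ?thesis .
  qed
  then show ?thesis
    using ne int by (simp add: absorbing_def right_semicentral_def E_idem)
qed

lemma minimal_absorbing_orthogonal:
  assumes I: "minimal_absorbing I" and J: "minimal_absorbing J" and ne: "I \<noteq> J"
  shows "E I \<otimes> E J = \<zero>"
proof -
  note ID = minimal_absorbingD[OF I] and JD = minimal_absorbingD[OF J]
  have "I \<inter> J = {}"
    using absorbing_Int[OF ID(1) JD(1)] ID(5)[of "I \<inter> J"] JD(5)[of "I \<inter> J"] ne by blast
  then show ?thesis using ID(2) JD(2) by (simp add: E_mult)
qed

end

section \<open>The maximal left denominator sets\<close>

text \<open>The assumption \<open>dichotomy\<close> is the form in which the simplicity of the components of
  \<open>R / rad(R)\<close> enters; see \<open>simple_component_dichotomy\<close>.\<close>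

locale artinian_idempotents = complete_idempotents +
  assumes artinian: "left_artinian R"
    and dichotomy: "\<And>A i. \<lbrakk>ideal A R; i \<in> {1..s}\<rbrakk> \<Longrightarrow>
      (\<exists>a\<in>A. u i \<ominus> a \<in> jacobson_radical R) \<or> (\<forall>a\<in>A. u i \<otimes> a \<in> jacobson_radical R)"
begin

text \<open>With \<open>K\<close> the set of \<open>i\<close> for which \<open>u i\<close> lies in \<open>A = (1 - e) R\<close> modulo the radical and \<open>I\<close> its
  complement, both \<open>e (E K)\<close> and \<open>(E I) (1 - e)\<close> lie in the radical. Both are
  idempotent, hence zero, so \<open>e (E I) = e\<close> and \<open>(E I) e = E I\<close>: the two have the same right annihilator.\<close>

lemma semicentral_right_ann_eq:
  assumes e: "right_semicentral R e" and e0: "e \<noteq> \<zero>"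
  obtains I where "absorbing I" "right_ann R e = right_ann R (E I)"
proof -
  let ?A = "right_ann R e" and ?J = "jacobson_radical R"
  have ec: "e \<in> carrier R" "e \<otimes> e = e" using e by (auto simp: right_semicentral_def)
  have A: "ideal ?A R" by (rule ideal_right_ann[OF e])
  define K where "K = {i \<in> {1..s}. \<exists>a\<in>?A. u i \<ominus> a \<in> ?J}"
  define I where "I = {1..s} - K"
  have sub: "I \<subseteq> {1..s}" "K \<subseteq> {1..s}" "{1..s} - I = K" by (auto simp: I_def K_def)
  have fin: "finite I" "finite K" using sub finite_subset by blast+
  have EI: "E I \<in> carrier R" "E K \<in> carrier R" using sub by auto
  have compl: "\<one> \<ominus> E I = E K" using E_compl[OF sub(1)] sub(3) by simp
  note JL = left_idealD[OF left_ideal_jacobson_radical]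
  have "e \<otimes> E K = \<zero>"
  proof (rule idempotent_in_jacobson_radical)
    have "e \<otimes> u i \<in> ?J" if i: "i \<in> K" for i
    proof -
      obtain a where a: "a \<in> ?A" "u i \<ominus> a \<in> ?J" using i by (auto simp: K_def)
      have c: "u i \<in> carrier R" "a \<in> carrier R" "e \<otimes> a = \<zero>"
        using u_closed sub i a by (auto simp: right_ann_def)
      have "e \<otimes> (u i \<ominus> a) = e \<otimes> u i \<ominus> \<zero>" using c ec by (simp add: minus_r_distr)
      also have "\<dots> = e \<otimes> u i" using c ec by (simp add: minus_eq)
      finally show ?thesis using JL(5)[OF a(2) ec(1)] by simp
    qed
    then have "(\<Oplus>i\<in>K. e \<otimes> u i) \<in> ?J"
      by (intro left_ideal_finsum left_ideal_jacobson_radical fin)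
    moreover have "e \<otimes> E K = (\<Oplus>i\<in>K. e \<otimes> u i)"
      unfolding idem_sum_def using fin ec sub u_closed by (intro finsum_rdistr) auto
    ultimately show "e \<otimes> E K \<in> ?J" by simp
    have "e \<otimes> E K \<otimes> (e \<otimes> E K) = e \<otimes> E K \<otimes> e \<otimes> E K" using ec EI by (simp add: m_assoc)
    also have "\<dots> = e \<otimes> E K \<otimes> E K" using e EI by (simp add: right_semicentral_def)
    also have "\<dots> = e \<otimes> E K" using ec EI E_idem[OF sub(2)] by (simp add: m_assoc)
    finally show "e \<otimes> E K \<otimes> (e \<otimes> E K) = e \<otimes> E K" .
  qed
  then have eEI: "e \<otimes> E I = e"
    using mult_compl_zero_iff[of e "E I"] ec EI compl by simp
  have "E I \<otimes> (\<one> \<ominus> e) = \<zero>"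
  proof (rule idempotent_in_jacobson_radical)
    have ne: "\<one> \<ominus> e \<in> ?A" using ec by (simp add: right_ann_def minus_r_distr minus_eq_zero_iff)
    have nec: "\<one> \<ominus> e \<in> carrier R" using ec by simp
    have "u i \<otimes> (\<one> \<ominus> e) \<in> ?J" if "i \<in> I" for i
      using that dichotomy[OF A, of i] ne by (auto simp: I_def K_def)
    then have "(\<Oplus>i\<in>I. u i \<otimes> (\<one> \<ominus> e)) \<in> ?J"
      by (intro left_ideal_finsum left_ideal_jacobson_radical fin)
    moreover have "E I \<otimes> (\<one> \<ominus> e) = (\<Oplus>i\<in>I. u i \<otimes> (\<one> \<ominus> e))"
      unfolding idem_sum_def using fin nec sub u_closed by (intro finsum_ldistr) auto
    ultimately show "E I \<otimes> (\<one> \<ominus> e) \<in> ?J" by simp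
    have "E I \<otimes> (\<one> \<ominus> e) \<in> ?A" using ideal.I_l_closed[OF A ne EI(1)] .
    then have "(\<one> \<ominus> e) \<otimes> (E I \<otimes> (\<one> \<ominus> e)) = E I \<otimes> (\<one> \<ominus> e)"
      using right_princ_compl[OF ec] right_princ_idempotent[OF nec idempotent_compl[OF ec]] by blast
    then have "E I \<otimes> (\<one> \<ominus> e) \<otimes> (E I \<otimes> (\<one> \<ominus> e)) = E I \<otimes> (E I \<otimes> (\<one> \<ominus> e))"
      using EI nec by (simp add: m_assoc)
    also have "\<dots> = E I \<otimes> E I \<otimes> (\<one> \<ominus> e)" using EI nec by (simp add: m_assoc)
    finally show "E I \<otimes> (\<one> \<ominus> e) \<otimes> (E I \<otimes> (\<one> \<ominus> e)) = E I \<otimes> (\<one> \<ominus> e)"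
      using E_idem[OF sub(1)] by simp
  qed
  then have EIe: "E I \<otimes> e = E I" using mult_compl_zero_iff[of "E I" e] ec EI by simp
  have ann: "?A = right_ann R (E I)"
  proof -
    have "e \<otimes> r = \<zero> \<longleftrightarrow> E I \<otimes> r = \<zero>" if r: "r \<in> carrier R" for r
    proof
      assume "e \<otimes> r = \<zero>"
      then have "E I \<otimes> e \<otimes> r = \<zero>" using m_assoc[OF EI(1) ec(1) r] EI by simp
      then show "E I \<otimes> r = \<zero>" using EIe by simp
    next
      assume "E I \<otimes> r = \<zero>"
      then have "e \<otimes> E I \<otimes> r = \<zero>" using m_assoc[OF ec(1) EI(1) r] ec by simp
      then show "e \<otimes> r = \<zero>" using eEI by simp
    qed
    then show ?thesis by (auto simp: right_ann_def)
  qed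
  have "E I \<otimes> r \<otimes> E I = E I \<otimes> r" if r: "r \<in> carrier R" for r
  proof -
    have "E K \<in> ?A" using \<open>e \<otimes> E K = \<zero>\<close> EI by (simp add: right_ann_def)
    then have "r \<otimes> E K \<in> right_ann R (E I)" using ideal.I_l_closed[OF A _ r] ann by simp
    then have "E I \<otimes> r \<otimes> (\<one> \<ominus> E I) = \<zero>" using r EI compl by (simp add: right_ann_def m_assoc)
    then show ?thesis using mult_compl_zero_iff[of "E I \<otimes> r" "E I"] r EI by simp
  qed
  moreover have "I \<noteq> {}" using eEI e0 ec by auto
  ultimately have "absorbing I"
    using sub EI E_idem[OF sub(1)] by (auto simp: absorbing_def right_semicentral_def)
  then show ?thesis using that ann by blast
qed

lemma E_nonzero: "absorbing I \<Longrightarrow> E I \<noteq> \<zero>"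
  using E_eq_iff[of I "{}"] absorbingD[of I] by auto

lemma right_ann_E_mono:
  assumes "J \<subseteq> I" "I \<subseteq> {1..s}"
  shows "right_ann R (E I) \<subseteq> right_ann R (E J)"
proof
  have J: "J \<subseteq> {1..s}" using assms by blast
  fix r assume "r \<in> right_ann R (E I)"
  then have r: "r \<in> carrier R" "E I \<otimes> r = \<zero>" by (auto simp: right_ann_def)
  have "E J \<otimes> r = E J \<otimes> E I \<otimes> r" using E_absorb_iff[OF J assms(2)] assms by simp
  also have "\<dots> = \<zero>" using m_assoc[of "E J" "E I" r] J assms r by simp
  finally show "r \<in> right_ann R (E J)" using r by (simp add: right_ann_def)
qed

lemma right_ann_E_subsetD:
  assumes I: "I \<subseteq> {1..s}" and J: "J \<subseteq> {1..s}" and sub: "right_ann R (E I) \<subseteq> right_ann R (E J)"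
  shows "J \<subseteq> I"
proof -
  have "\<one> \<ominus> E I \<in> right_ann R (E I)"
    using I E_idem[OF I] by (simp add: right_ann_def mult_compl_zero_iff)
  then have "E J \<otimes> (\<one> \<ominus> E I) = \<zero>" using sub by (auto simp: right_ann_def)
  then have "E J \<otimes> E I = E J" using mult_compl_zero_iff[of "E J" "E I"] I J by simp
  then show ?thesis using E_absorb_iff[OF J I] by simp
qed

text \<open>If \<open>J \<subseteq> I\<close> then the right annihilator of \<open>E J\<close> contains that of \<open>E I\<close>, and more elements are
  invertible modulo the larger ideal; so minimal index sets give the maximal denominator sets. Conversely a
  denominator set containing the one of a minimal \<open>I\<close> has a larger \<open>ass\<close>, hence an index set
  inside \<open>I\<close>, hence the same index set.\<close>

theorem max_Den_l_eq: "max_Den_l R = (\<lambda>I. units_mod R (E I)) ` {I. minimal_absorbing I}"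
proof -
  have den: "left_denominator_set R (units_mod R (E I))"
    and ass: "ass R (units_mod R (E I)) = right_ann R (E I)" if "absorbing I" for I
    using left_denominator_set_units_mod[of "E I"] absorbingD(3)[OF that] E_nonzero[OF that] by auto
  have classify: "\<exists>I. absorbing I \<and> ass R S = right_ann R (E I) \<and> S \<subseteq> units_mod R (E I)"
    if S: "left_denominator_set R S" for S
  proof -
    obtain e where e: "right_semicentral R e" "e \<noteq> \<zero>" "ass R S = right_ann R e"
      "S \<subseteq> units_mod R e"
      using left_denominator_set_idempotent[OF artinian S] .
    obtain I where I: "absorbing I" "right_ann R e = right_ann R (E I)"
      using semicentral_right_ann_eq[OF e(1,2)] .
    have "units_mod R e \<subseteq> units_mod R (E I)"
      using e(1) I absorbingD(1)[OF I(1)]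
      by (intro units_mod_mono) (auto simp: right_semicentral_def)
    then show ?thesis using e I by blast
  qed
  show ?thesis
  proof (intro subset_antisym subsetI)
    fix S assume "S \<in> max_Den_l R"
    then have S: "left_denominator_set R S"
      and max: "\<And>T. \<lbrakk>left_denominator_set R T; S \<subseteq> T\<rbrakk> \<Longrightarrow> T = S"
      by (auto simp: max_Den_l_def)
    obtain I where I: "absorbing I" "S \<subseteq> units_mod R (E I)" using classify[OF S] by blast
    obtain J where J: "minimal_absorbing J" "J \<subseteq> I" using exists_minimal_absorbing[OF I(1)] .
    have "units_mod R (E I) \<subseteq> units_mod R (E J)"
      using absorbingD(1)[OF I(1)] minimal_absorbingD(2)[OF J(1)] J(2)
      by (intro units_mod_mono right_ann_E_mono) auto
    then have "units_mod R (E J) = S" using max[OF den[OF minimal_absorbingD(1)[OF J(1)]]] I(2) by blast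
    then show "S \<in> (\<lambda>I. units_mod R (E I)) ` {I. minimal_absorbing I}" using J(1) by blast
  next
    fix S assume "S \<in> (\<lambda>I. units_mod R (E I)) ` {I. minimal_absorbing I}"
    then obtain I where I: "minimal_absorbing I" "S = units_mod R (E I)" by auto
    note ID = minimal_absorbingD[OF I(1)]
    have "T = S" if T: "left_denominator_set R T" "S \<subseteq> T" for T
    proof -
      obtain J where J: "absorbing J" "ass R T = right_ann R (E J)" "T \<subseteq> units_mod R (E J)"
        using classify[OF T(1)] by blast
      have "ass R S \<subseteq> ass R T" using T(2) by (auto simp: ass_def)
      then have "right_ann R (E I) \<subseteq> right_ann R (E J)" using ass[OF ID(1)] I(2) J(2) by simp
      then have "J \<subseteq> I" by (rule right_ann_E_subsetD[OF ID(2) absorbingD(1)[OF J(1)]])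
      then have "J = I" using ID(5)[OF J(1)] by blast
      then show ?thesis using J(3) T(2) I(2) by blast
    qed
    then show "S \<in> max_Den_l R" using den[OF ID(1)] I(2) by (auto simp: max_Den_l_def)
  qed
qed

lemma left_localization_radical_eq:
  "left_localization_radical R = {r \<in> carrier R. \<forall>e\<in>min_I_l' R u s. e \<otimes> r = \<zero>}"
proof -
  have "ass R (units_mod R (E I)) = right_ann R (E I)" if "minimal_absorbing I" for I
    using left_denominator_set_units_mod(2)[of "E I"] minimal_absorbingD(1,4)[OF that] E_nonzero by blast
  then show ?thesis
    by (auto simp: left_localization_radical_def max_Den_l_eq min_I_l'_eq right_ann_def)
qed

end

section \<open>The left localization radical\<close>

lemma atLeastAtMost_add_one_insert: "{1..t + 1} = insert (t + 1) {1..t :: nat}"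
  by auto

context artinian_idempotents
begin

abbreviation "min_idems \<equiv> min_I_l' R u s"
abbreviation "min_sum \<equiv> \<Oplus>e\<in>min_idems. e"
abbreviation "loc_rad \<equiv> left_localization_radical R"

lemma min_I_l'D:
  assumes "e \<in> min_idems"
  shows "e \<in> carrier R" "e \<otimes> e = e" "right_semicentral R e"
  using assms by (auto simp: min_I_l'_eq right_semicentral_def dest: minimal_absorbingD(4))

lemma min_I_l'_orthogonal: "\<lbrakk>e \<in> min_idems; f \<in> min_idems; e \<noteq> f\<rbrakk> \<Longrightarrow> e \<otimes> f = \<zero>"
  using minimal_absorbing_orthogonal by (auto simp: min_I_l'_eq)

lemma min_sum_idempotent: "min_sum \<in> carrier R" "min_sum \<otimes> min_sum = min_sum"
proof -
  show "min_sum \<in> carrier R" using min_I_l'D(1) by (intro finsum_closed) auto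
  show "min_sum \<otimes> min_sum = min_sum"
    using orthogonal_sum_mult[of min_idems "\<lambda>e. e" min_idems min_idems] finite_min_I_l'[of R u s]
      min_I_l'D(1,2) min_I_l'_orthogonal by auto
qed

lemma radical_eq_right_princ: "loc_rad = right_princ R (\<one> \<ominus> min_sum)"
proof -
  have "loc_rad = right_ann R min_sum"
    unfolding left_localization_radical_eq
    by (rule right_ann_finsum_orthogonal[symmetric])
      (use finite_min_I_l'[of R u s] min_I_l'D(1,2) min_I_l'_orthogonal in auto)
  then show ?thesis using right_princ_compl[OF min_sum_idempotent] by simp
qed

lemma compl_min_sum_idempotent:
  "\<one> \<ominus> min_sum \<in> carrier R" "(\<one> \<ominus> min_sum) \<otimes> (\<one> \<ominus> min_sum) = \<one> \<ominus> min_sum"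
  using min_sum_idempotent idempotent_compl[OF min_sum_idempotent] by auto

lemma radical_eq_Inter: "loc_rad = carrier R \<inter> (\<Inter>e\<in>min_idems. right_princ R (\<one> \<ominus> e))"
proof -
  have "right_princ R (\<one> \<ominus> e) = right_ann R e" if "e \<in> min_idems" for e
    using right_princ_compl min_I_l'D(1,2)[OF that] .
  then show ?thesis by (auto simp: left_localization_radical_eq right_ann_def)
qed

lemma radical_is_prod: "is_ideal_prod R min_idems (\<lambda>e. right_princ R (\<one> \<ominus> e)) loc_rad"
  unfolding is_ideal_prod_def
proof (intro conjI allI impI)
  show "finite min_idems" by (rule finite_min_I_l')
  fix es assume es: "distinct es \<and> set es = min_idems"
  then have eq: "map (\<lambda>e. right_princ R (\<one> \<ominus> e)) es = map (right_ann R) es"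
    using right_princ_compl min_I_l'D(1,2) by (intro map_cong) auto
  show "ideal_list_prod R (map (\<lambda>e. right_princ R (\<one> \<ominus> e)) es) = loc_rad"
    unfolding eq left_localization_radical_eq
    using ideal_list_prod_right_ann[of es] es min_I_l'D(3) by simp
qed

lemma right_princ_E: "I \<subseteq> {1..s} \<Longrightarrow> right_princ R (E ({1..s} - I)) = right_ann R (E I)"
  using right_princ_compl[OF E_closed E_idem] E_compl by simp

text \<open>Unless \<open>{1..s}\<close> is itself minimal or empty, \<open>f \<mapsto> 1 - f\<close> maps the maximal elements of
  \<open>\<I>\<^sub>r''(R)\<close> onto the minimal ones of \<open>\<I>\<^sub>l'(R)\<close>. In the exceptional cases there is no such \<open>f\<close>;
  there \<open>1\<close> is the only minimal element, or the ring is zero, and the localization radical vanishes.\<close>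

lemma radical_is_prod_max:
  "if max_I_r'' R u s = {} then loc_rad = {\<zero>}
   else is_ideal_prod R (max_I_r'' R u s) (\<lambda>f. right_princ R f) loc_rad"
proof (cases "minimal_absorbing {1..s} \<or> {1..s} = {}")
  case True
  have zero: "\<zero> \<in> loc_rad"
    unfolding left_localization_radical_eq using min_I_l'D(1) r_null by simp
  have "r = \<zero>" if r: "r \<in> loc_rad" for r
  proof (cases "{1..s} = {}")
    case True
    then have "\<one> = \<zero>" using E_full E_empty by metis
    then have "carrier R = {\<zero>}" by (rule one_zeroD)
    then show ?thesis using r unfolding left_localization_radical_eq by blast
  next
    case False
    then have "minimal_absorbing {1..s}" using True by blast
    then have "E {1..s} \<in> min_idems" unfolding min_I_l'_eq by blast
    then have "\<one> \<otimes> r = \<zero>" "r \<in> carrier R"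
      using r unfolding left_localization_radical_eq E_full by blast+
    then show ?thesis by simp
  qed
  then have "loc_rad = {\<zero>}" using zero by blast
  moreover have "max_I_r'' R u s = {}"
  proof -
    have "I = {1..s}" if I: "minimal_absorbing I" for I
      using True
    proof
      assume "minimal_absorbing {1..s}"
      then show ?thesis using minimal_absorbingD(5) minimal_absorbingD(1,2)[OF I] by blast
    qed (use minimal_absorbingD(2,3)[OF I] in blast)
    then show ?thesis unfolding max_I_r''_eq by blast
  qed
  ultimately show ?thesis by simp
next
  case False
  let ?f = "\<lambda>I. E ({1..s} - I)"
  have mx: "max_I_r'' R u s = ?f ` {I. minimal_absorbing I}"
    using False unfolding max_I_r''_eq by blast
  obtain I where "minimal_absorbing I"
    using exists_minimal_absorbing[OF absorbing_full] False by blast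
  then have ne: "max_I_r'' R u s \<noteq> {}" using mx by blast
  have "is_ideal_prod R (max_I_r'' R u s) (\<lambda>f. right_princ R f) loc_rad"
    unfolding is_ideal_prod_def
  proof (intro conjI allI impI)
    show "finite (max_I_r'' R u s)" by (rule finite_max_I_r'')
    fix fs assume fs: "distinct fs \<and> set fs = max_I_r'' R u s"
    have f: "\<exists>I. minimal_absorbing I \<and> f = E ({1..s} - I) \<and> \<one> \<ominus> f = E I" if f: "f \<in> set fs" for f
    proof -
      obtain I where I: "minimal_absorbing I" "f = E ({1..s} - I)" using f fs mx by auto
      have "{1..s} - ({1..s} - I) = I" using minimal_absorbingD(2)[OF I(1)] by blast
      then show ?thesis using I E_compl[of "{1..s} - I"] by auto
    qed
    have "right_princ R f = right_ann R (\<one> \<ominus> f)" if ff: "f \<in> set fs" for f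
    proof -
      obtain I where I: "minimal_absorbing I" "f = E ({1..s} - I)" "\<one> \<ominus> f = E I"
        using f[OF ff] by blast
      show ?thesis
        unfolding I(3) unfolding I(2) by (rule right_princ_E[OF minimal_absorbingD(2)[OF I(1)]])
    qed
    then have "map (\<lambda>f. right_princ R f) fs = map (right_ann R) (map (\<lambda>f. \<one> \<ominus> f) fs)"
      by simp
    moreover have "set (map (\<lambda>f. \<one> \<ominus> f) fs) = min_idems"
    proof
      show "set (map (\<lambda>f. \<one> \<ominus> f) fs) \<subseteq> min_idems"
      proof
        fix e assume "e \<in> set (map (\<lambda>f. \<one> \<ominus> f) fs)"
        then obtain f where "f \<in> set fs" "e = \<one> \<ominus> f" by auto
        then show "e \<in> min_idems" using f[of f] unfolding min_I_l'_eq by blast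
      qed
      show "min_idems \<subseteq> set (map (\<lambda>f. \<one> \<ominus> f) fs)"
      proof
        fix e assume "e \<in> min_idems"
        then obtain I where I: "minimal_absorbing I" "e = E I" by (auto simp: min_I_l'_eq)
        have "{1..s} - ({1..s} - I) = I" using minimal_absorbingD(2)[OF I(1)] by blast
        then have "e = \<one> \<ominus> ?f I" using I E_compl[of "{1..s} - I"] by auto
        moreover have "?f I \<in> set fs" using I mx fs by blast
        ultimately show "e \<in> set (map (\<lambda>f. \<one> \<ominus> f) fs)" by simp
      qed
    qed
    ultimately show "ideal_list_prod R (map (\<lambda>f. right_princ R f) fs) = loc_rad"
      using ideal_list_prod_right_ann[of "map (\<lambda>f. \<one> \<ominus> f) fs"] min_I_l'D(3)
      by (simp only: left_localization_radical_eq)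
  qed
  then show ?thesis using ne by simp
qed

lemma radical_zero_iff: "loc_rad = {\<zero>} \<longleftrightarrow> \<one> = min_sum"
  unfolding radical_eq_right_princ right_princ_eq_zero_iff[OF compl_min_sum_idempotent]
  by (rule minus_eq_zero_iff[OF one_closed min_sum_idempotent(1)])

lemma radical_peirce_decomposition:
  fixes e :: "nat \<Rightarrow> 'a" and t :: nat
  assumes bij: "bij_betw e {1..t} min_idems" and last: "e (t + 1) = \<one> \<ominus> (\<Oplus>i\<in>{1..t}. e i)"
  shows "internal_direct_sum R {1..t+1} (\<lambda>i. peirce R (e (t + 1)) (e i)) loc_rad"
proof -
  have inj: "inj_on e {1..t}" and img: "e ` {1..t} = min_idems" using bij by (auto simp: bij_betw_def)
  have e: "e i \<in> min_idems" if "i \<in> {1..t}" for i using img that by blast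
  have "(\<Oplus>x\<in>e ` {1..t}. x) = (\<Oplus>i\<in>{1..t}. e i)"
    using e min_I_l'D(1) by (intro finsum_reindex inj) auto
  then have sum: "(\<Oplus>i\<in>{1..t}. e i) = min_sum" using img by simp
  then have g: "e (t + 1) = \<one> \<ominus> min_sum" using last by simp
  have absorb: "x \<otimes> min_sum = x" "min_sum \<otimes> x = x" if x: "x \<in> min_idems" for x
  proof -
    have "x \<otimes> min_sum = (if x \<in> min_idems then x else \<zero>)"
      by (rule orthogonal_sum_absorb[OF finite_min_I_l' _ min_I_l'D(2) min_I_l'_orthogonal x])
        (auto intro: min_I_l'D(1))
    then show "x \<otimes> min_sum = x" using x by simp
    have single: "(\<Oplus>e\<in>{x}. e) = x" "min_idems \<inter> {x} = {x}" using min_I_l'D(1)[OF x] x by auto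
    have "min_sum \<otimes> (\<Oplus>e\<in>{x}. e) = (\<Oplus>e\<in>min_idems \<inter> {x}. e)"
      by (rule orthogonal_sum_mult[OF finite_min_I_l' _ min_I_l'D(2) min_I_l'_orthogonal])
        (use x in \<open>auto intro: min_I_l'D(1)\<close>)
    then show "min_sum \<otimes> x = x" unfolding single .
  qed
  note split = atLeastAtMost_add_one_insert[of t]
  show ?thesis
    unfolding radical_eq_right_princ g[symmetric]
  proof (rule internal_direct_sum_peirce)
    show "e \<in> {1..t+1} \<rightarrow> carrier R"
      using e min_I_l'D(1) g compl_min_sum_idempotent(1) unfolding split by auto
    show "e i \<otimes> e i = e i" if "i \<in> {1..t+1}" for i
      using that e min_I_l'D(2) g compl_min_sum_idempotent(2) unfolding split by auto
    show "e i \<otimes> e j = \<zero>" if ij: "i \<in> {1..t+1}" "j \<in> {1..t+1}" "i \<noteq> j" for i j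
    proof -
      consider "i \<in> {1..t}" "j \<in> {1..t}" | "i = t + 1" "j \<in> {1..t}" | "i \<in> {1..t}" "j = t + 1"
        using ij unfolding split by blast
      then show ?thesis
      proof cases
        case 1
        then have "e i \<noteq> e j" using inj ij(3) by (auto dest: inj_onD)
        then show ?thesis using 1 e min_I_l'_orthogonal by blast
      next
        case 2
        then show ?thesis
          using g e[of j] absorb(2) min_I_l'D(1)[of "e j"] min_sum_idempotent(1)
          by (simp add: minus_l_distr minus_eq_zero_iff)
      next
        case 3
        then show ?thesis
          using g e[of i] absorb(1) min_I_l'D(1)[of "e i"] min_sum_idempotent(1)
          by (simp add: minus_r_distr minus_eq_zero_iff)
      qed
    qed
    have "(\<Oplus>i\<in>{1..t+1}. e i) = e (t + 1) \<oplus> (\<Oplus>i\<in>{1..t}. e i)"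
      unfolding split using e min_I_l'D(1) g compl_min_sum_idempotent(1)
      by (intro finsum_insert) auto
    also have "\<dots> = (\<one> \<ominus> min_sum) \<oplus> min_sum" using g sum by simp
    also have "\<dots> = \<one>" by (rule minus_add_cancel[OF one_closed min_sum_idempotent(1)])
    finally show "(\<Oplus>i\<in>{1..t+1}. e i) = \<one>" .
    show "e (t + 1) \<in> carrier R" using g compl_min_sum_idempotent(1) by simp
  qed simp
qed

text \<open>The localization radical is generated by an idempotent, which is zero as soon as it lies in \<open>rad(R)\<close>.\<close>

lemma radical_subset_jacobson_iff: "loc_rad \<subseteq> jacobson_radical R \<longleftrightarrow> loc_rad = {\<zero>}"
proof
  assume sub: "loc_rad \<subseteq> jacobson_radical R"
  have "\<one> \<ominus> min_sum \<in> loc_rad"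
    using compl_min_sum_idempotent by (simp add: radical_eq_right_princ right_princ_idempotent)
  then have "\<one> \<ominus> min_sum = \<zero>"
    using sub idempotent_in_jacobson_radical compl_min_sum_idempotent(2) by blast
  then show "loc_rad = {\<zero>}"
    unfolding radical_eq_right_princ using right_princ_eq_zero_iff[OF compl_min_sum_idempotent] by simp
next
  assume "loc_rad = {\<zero>}"
  then show "loc_rad \<subseteq> jacobson_radical R"
    using left_idealD(2)[OF left_ideal_jacobson_radical] by simp
qed

end

lemma (in ring) trivial_if_one_eq_zero: "\<one> = \<zero> \<Longrightarrow> carrier R = {\<zero>}"
  by (rule one_zeroD)

lemma artinian_idempotentsI:
  fixes R :: "('a, 'r) ring_scheme" (structure)
    and s :: nat and u :: "nat \<Rightarrow> 'a"
    and Rb :: "nat \<Rightarrow> 'a set set" and ob :: "nat \<Rightarrow> 'a set"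
  assumes R: "ring R" "left_artinian R"
    and Rb: "\<And>i. i \<in> {1..s} \<Longrightarrow> ideal (Rb i) (R Quot jacobson_radical R)"
    and simple: "\<And>i. i \<in> {1..s} \<Longrightarrow>
           simple_ring ((R Quot jacobson_radical R)\<lparr>carrier := Rb i, one := ob i\<rparr>)"
    and u: "\<And>i. i \<in> {1..s} \<Longrightarrow> u i \<in> carrier R"
    and idem: "\<And>i. i \<in> {1..s} \<Longrightarrow> u i \<otimes> u i = u i"
    and orth: "\<And>i j. i \<in> {1..s} \<Longrightarrow> j \<in> {1..s} \<Longrightarrow> i \<noteq> j \<Longrightarrow> u i \<otimes> u j = \<zero>"
    and one: "\<one> = (\<Oplus>i\<in>{1..s}. u i)"
    and coset: "\<And>i. i \<in> {1..s} \<Longrightarrow> jacobson_radical R +> u i = ob i"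
  shows "artinian_idempotents R s u"
proof -
  interpret ring R by (rule R)
  note J = ideal_jacobson_radical
  have simple': "simple_ring ((R Quot jacobson_radical R)
      \<lparr>carrier := Rb i, one := jacobson_radical R +> u i\<rparr>)" if "i \<in> {1..s}" for i
    using simple[OF that] coset[OF that] by simp
  have nonzero: "u i \<noteq> \<zero>" if i: "i \<in> {1..s}" for i
  proof
    let ?K = "(R Quot jacobson_radical R)\<lparr>carrier := Rb i, one := jacobson_radical R +> u i\<rparr>"
    have K: "ring ?K" "carrier ?K \<noteq> {\<zero>\<^bsub>?K\<^esub>}"
      using simple'[OF i] unfolding simple_ring_def by (rule conjunct1, elim conjE)
    assume "u i = \<zero>"
    then have "\<one>\<^bsub>?K\<^esub> = \<zero>\<^bsub>?K\<^esub>"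
      using a_rcos_zero[OF J additive_subgroup.zero_closed[OF ideal.axioms(1)[OF J]]]
      by (simp add: zero_FactRing)
    then show False using ring.trivial_if_one_eq_zero[OF K(1)] K(2) by blast
  qed
  show ?thesis
    by (intro artinian_idempotents.intro complete_idempotents.intro
        complete_idempotents_axioms.intro artinian_idempotents_axioms.intro ring_axioms
        simple_component_dichotomy[OF J _ u Rb simple'] R(2))
      (use u idem orth one nonzero in auto)
qed

theorem theorem4p13:
  fixes R :: "('a, 'r) ring_scheme" (structure)
    and s :: nat and u :: "nat \<Rightarrow> 'a"
    and Rb :: "nat \<Rightarrow> 'a set set" and ob :: "nat \<Rightarrow> 'a set"
  assumes "ring R" and "left_artinian R"
    and "\<And>i. i \<in> {1..s} \<Longrightarrow> ideal (Rb i) (R Quot jacobson_radical R)"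
    and "internal_direct_sum (R Quot jacobson_radical R) {1..s} Rb
           (carrier (R Quot jacobson_radical R))"
    and "\<And>i. i \<in> {1..s} \<Longrightarrow>
           simple_ring ((R Quot jacobson_radical R)\<lparr>carrier := Rb i, one := ob i\<rparr>)"
    and "\<And>i. i \<in> {1..s} \<Longrightarrow>
           left_artinian ((R Quot jacobson_radical R)\<lparr>carrier := Rb i, one := ob i\<rparr>)"
    and "\<And>i. i \<in> {1..s} \<Longrightarrow> u i \<in> carrier R"
    and "\<And>i. i \<in> {1..s} \<Longrightarrow> u i \<otimes> u i = u i"
    and "\<And>i j. i \<in> {1..s} \<Longrightarrow> j \<in> {1..s} \<Longrightarrow> i \<noteq> j \<Longrightarrow> u i \<otimes> u j = \<zero>"
    and "\<one> = (\<Oplus>i\<in>{1..s}. u i)"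
    and "\<And>i. i \<in> {1..s} \<Longrightarrow> jacobson_radical R +> u i = ob i"
  shows "(let l = left_localization_radical R;
              mn = min_I_l' R u s;
              mx = max_I_r'' R u s
    in
      (l = carrier R \<inter> (\<Inter>e\<in>mn. right_princ R (\<one> \<ominus> e)) \<and>
       is_ideal_prod R mn (\<lambda>e. right_princ R (\<one> \<ominus> e)) l \<and>
       l = right_princ R (\<one> \<ominus> (\<Oplus>e\<in>mn. e)) \<and>
       (right_artinian R \<longrightarrow>
          (if mx = {} then l = {\<zero>} else is_ideal_prod R mx (\<lambda>f. right_princ R f) l)))
    \<and> (\<forall>t (e :: nat \<Rightarrow> 'a).
         bij_betw e {1..t} mn \<and> e (t + 1) = \<one> \<ominus> (\<Oplus>i\<in>{1..t}. e i) \<longrightarrow>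
         (if \<one> \<noteq> (\<Oplus>f\<in>mn. f)
          then internal_direct_sum R {1..t+1} (\<lambda>i. peirce R (e (t + 1)) (e i)) l \<and> l \<noteq> {\<zero>}
          else l = {\<zero>}))
    \<and> (ideal_prod R l l = l \<and>
       projective_right_module TYPE('m) TYPE('n) R (R\<lparr>carrier := l\<rparr>) (mult R))
    \<and> (l \<subseteq> jacobson_radical R \<longleftrightarrow> l = {\<zero>}))"
proof -
  interpret artinian_idempotents R s u
    by (rule artinian_idempotentsI[OF assms(1-3,5,7-11)])
  note g = compl_min_sum_idempotent
  have square: "ideal_prod R loc_rad loc_rad = loc_rad"
    unfolding radical_eq_right_princ by (rule ideal_prod_right_princ_self[OF g])
  have projective: "projective_right_module TYPE('m) TYPE('n) R (R\<lparr>carrier := loc_rad\<rparr>) (mult R)"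
    unfolding radical_eq_right_princ by (rule projective_right_princ[OF g])
  have peirce: "if \<one> \<noteq> min_sum
      then internal_direct_sum R {1..t+1} (\<lambda>i. peirce R (e (t + 1)) (e i)) loc_rad \<and> loc_rad \<noteq> {\<zero>}
      else loc_rad = {\<zero>}"
    if "bij_betw e {1..t} min_idems \<and> e (t + 1) = \<one> \<ominus> (\<Oplus>i\<in>{1..t}. e i)" for t and e :: "nat \<Rightarrow> 'a"
    using radical_peirce_decomposition[of e t] radical_zero_iff that by presburger
  show ?thesis
    unfolding Let_def
    by (intro conjI allI impI radical_eq_Inter radical_is_prod radical_eq_right_princ
        radical_is_prod_max peirce square projective radical_subset_jacobson_iff) simp_all
qed

end
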